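(* Let $X,Y\in\mathcal{B}_A(\mathcal{H})$ and $\beta\ge 0$. Then for all $r\ge 1$, $$\omega_{\mathbb{A}}^{4r}\left(\begin{bmatrix} 0& X\\ Y& 0\end{bmatrix}\right)\le \frac{2\beta+1}{16(\beta+1)}\max\{\lambda_r^2,\mu_r^2\}+\frac{2\beta+3}{8(\beta+1)}\max\{\lambda_r,\mu_r\}\max\{\omega_A^r(XY),\omega_A^r(YX)\},$$ where $\lambda_r=\|(Y^{\sharp_A}Y)^r+(XX^{\sharp_A})^r\|_A$ and $\mu_r=\|(YY^{\sharp_A})^r+(X^{\sharp_A}X)^r\|_A$.
   Context: $\mathcal{H}$ is a complex Hilbert space, $\mathcal{B}(\mathcal{H})$ the bounded linear operators on it, and $A\in\mathcal{B}(\mathcal{H})$ is a fixed positive (semidefinite) operator. Put $\langle x,y\rangle_A=\langle Ax,y\rangle$ and $\|x\|_A=\langle x,x\rangle_A^{1/2}$. $\mathcal{B}_A(\mathcal{H})$ is the set of $T\in\mathcal{B}(\mathcal{H})$ for which there is $S\in\mathcal{B}(\mathcal{H})$ with $AS=T^*A$; for such $T$, $T^{\sharp_A}=A^\dagger T^*A$ ($A^\dagger$ the Moore-Penrose inverse), i.e. the unique bounded solution $S$ of $AS=T^*A$ with range in $\overline{\mathrm{ran}(A)}$. The $A$-operator seminorm is $\|T\|_A=\sup\{\|Tx\|_A/\|x\|_A : x\in\overline{\mathrm{ran}(A)},\ x\ne 0\}$, and the $A$-numerical radius is $\omega_A(T)=\sup\{|\langle Tx,x\rangle_A| : x\in\mathcal{H},\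 \|x\|_A=1\}$. On $\mathcal{H}\oplus\mathcal{H}$ let $\mathbb{A}=\begin{bmatrix}A&0\\0&A\end{bmatrix}$; $\omega_{\mathbb{A}}$ is defined as $\omega_A$ with $\mathbb{A}$ in place of $A$. $\omega_A^s(T)$ means $(\omega_A(T))^s$. Powers: an operator $S\in\mathcal{B}_A(\mathcal{H})$ is $A$-positive if $AS\ge 0$ (e.g. $T^{\sharp_A}T$ and $TT^{\sharp_A}$). Every $S\in\mathcal{B}_A(\mathcal{H})$ induces a bounded operator $\tilde S$ on the Hilbert space completion of $\mathcal{H}/\ker A$ under $\langle\cdot,\cdot\rangle_A$, with $\|\tilde S\|=\|S\|_A$, and $\tilde S\ge 0$ if $S$ is $A$-positive; for real $r>0$ and $A$-positive $S,R$, $\|S^r+R^r\|_A$ means $\|\tilde S^r+\tilde R^r\|$ (for integer $r$ this is the seminorm of the ordinary sum of powers). *)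

theory Defs
  imports "HOL-Analysis.Analysis"
begin

section \<open>Complex Hilbert spaces\<close>

text \<open>
  The complex inner product is linear in the first argument. The underlying real Hilbert space
  structure (norm, topology, real inner product) is the one of the library.
\<close>

class complex_inner = real_inner +
  fixes scaleC :: "complex \<Rightarrow> 'a \<Rightarrow> 'a" (infixr "*\<^sub>C" 75)
    and cinner :: "'a \<Rightarrow> 'a \<Rightarrow> complex"
  assumes scaleC_add_right: "c *\<^sub>C (x + y) = c *\<^sub>C x + c *\<^sub>C y"
    and scaleC_add_left: "(c + d) *\<^sub>C x = c *\<^sub>C x + d *\<^sub>C x"
    and scaleC_scaleC: "c *\<^sub>C d *\<^sub>C x = (c * d) *\<^sub>C x"
    and scaleR_scaleC: "s *\<^sub>R x = complex_of_real s *\<^sub>C x"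
    and cinner_commute: "cinner x y = cnj (cinner y x)"
    and cinner_add_left: "cinner (x + y) z = cinner x z + cinner y z"
    and cinner_scaleC_left: "cinner (c *\<^sub>C x) y = c * cinner x y"
    and inner_eq_Re_cinner: "inner x y = Re (cinner x y)"

class chilbert_space = complex_inner + complete_space

instantiation prod :: (complex_inner, complex_inner) complex_inner
begin

definition scaleC_prod :: "complex \<Rightarrow> 'a \<times> 'b \<Rightarrow> 'a \<times> 'b" where
  "scaleC_prod c x = (c *\<^sub>C fst x, c *\<^sub>C snd x)"

definition cinner_prod :: "'a \<times> 'b \<Rightarrow> 'a \<times> 'b \<Rightarrow> complex" where
  "cinner_prod x y = cinner (fst x) (fst y) + cinner (snd x) (snd y)"

instance
proof
  fix x y z :: "'a \<times> 'b" and c d :: complex and s :: real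
  show "c *\<^sub>C (x + y) = c *\<^sub>C x + c *\<^sub>C y"
    by (simp add: scaleC_prod_def scaleC_add_right)
  show "(c + d) *\<^sub>C x = c *\<^sub>C x + d *\<^sub>C x"
    by (simp add: scaleC_prod_def scaleC_add_left)
  show "c *\<^sub>C d *\<^sub>C x = (c * d) *\<^sub>C x"
    by (simp add: scaleC_prod_def scaleC_scaleC)
  show "s *\<^sub>R x = complex_of_real s *\<^sub>C x"
    by (simp add: scaleC_prod_def scaleR_prod_def scaleR_scaleC)
  show "cinner x y = cnj (cinner y x)"
    unfolding cinner_prod_def
    by (metis cinner_commute complex_cnj_add)
  show "cinner (x + y) z = cinner x z + cinner y z"
    by (simp add: cinner_prod_def cinner_add_left)
  show "cinner (c *\<^sub>C x) y = c * cinner x y"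
    by (simp add: cinner_prod_def scaleC_prod_def cinner_scaleC_left distrib_left)
  show "inner x y = Re (cinner x y)"
    by (simp add: cinner_prod_def inner_prod_def inner_eq_Re_cinner)
qed

end

instance prod :: (chilbert_space, chilbert_space) chilbert_space ..


section \<open>Bounded operators\<close>

text \<open>
  The type of bounded linear functions of the library consists of real-linear maps; the bounded
  operators of a complex Hilbert space are the complex-linear ones among them.
\<close>

definition bounded_ops :: "('h::complex_inner \<Rightarrow>\<^sub>L 'h) set" where
  "bounded_ops = {T. \<forall>c x. blinfun_apply T (c *\<^sub>C x) = c *\<^sub>C blinfun_apply T x}"

definition positive_op :: "('h::complex_inner \<Rightarrow>\<^sub>L 'h) \<Rightarrow> bool" where
  "positive_op T \<longleftrightarrow> T \<in> bounded_ops \<and> (\<forall>x. cinner (blinfun_apply T x) x \<in> \<real>\<^sub>\<ge>\<^sub>0)"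

definition cadjoint :: "('h::chilbert_space \<Rightarrow>\<^sub>L 'h) \<Rightarrow> ('h \<Rightarrow>\<^sub>L 'h)" where
  "cadjoint T = (THE S. \<forall>x y. cinner (blinfun_apply T x) y = cinner x (blinfun_apply S y))"

lift_definition block_op ::
  "('h::complex_inner \<Rightarrow>\<^sub>L 'h) \<Rightarrow> ('h \<Rightarrow>\<^sub>L 'h) \<Rightarrow> ('h \<Rightarrow>\<^sub>L 'h) \<Rightarrow> ('h \<Rightarrow>\<^sub>L 'h)
     \<Rightarrow> (('h \<times> 'h) \<Rightarrow>\<^sub>L ('h \<times> 'h))"
  is "\<lambda>T11 T12 T21 T22 x. (T11 (fst x) + T12 (snd x), T21 (fst x) + T22 (snd x))"
  by (intro bounded_linear_Pair bounded_linear_add)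
     (auto intro: bounded_linear_compose bounded_linear_fst bounded_linear_snd)


section \<open>The semi-inner product induced by a positive operator\<close>

definition A_inner :: "('h::complex_inner \<Rightarrow>\<^sub>L 'h) \<Rightarrow> 'h \<Rightarrow> 'h \<Rightarrow> complex" where
  "A_inner A x y = cinner (blinfun_apply A x) y"

definition A_norm :: "('h::complex_inner \<Rightarrow>\<^sub>L 'h) \<Rightarrow> 'h \<Rightarrow> real" where
  "A_norm A x = sqrt (Re (A_inner A x x))"

definition A_adjointable :: "('h::chilbert_space \<Rightarrow>\<^sub>L 'h) \<Rightarrow> ('h \<Rightarrow>\<^sub>L 'h) set" where
  "A_adjointable A =
     {T \<in> bounded_ops. \<exists>S\<in>bounded_ops. A o\<^sub>L S = cadjoint T o\<^sub>L A}"

definition A_adjoint ::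
  "('h::chilbert_space \<Rightarrow>\<^sub>L 'h) \<Rightarrow> ('h \<Rightarrow>\<^sub>L 'h) \<Rightarrow> ('h \<Rightarrow>\<^sub>L 'h)" where
  "A_adjoint A T =
     (THE S. S \<in> bounded_ops \<and> A o\<^sub>L S = cadjoint T o\<^sub>L A \<and>
             range (blinfun_apply S) \<subseteq> closure (range (blinfun_apply A)))"

text \<open>
  All values are nonnegative, so adding 0 to the set only matters when the set is empty
  (that is, when A is zero); the supremum is then 0.
\<close>

definition A_numerical_radius :: "('h::complex_inner \<Rightarrow>\<^sub>L 'h) \<Rightarrow> ('h \<Rightarrow>\<^sub>L 'h) \<Rightarrow> real" where
  "A_numerical_radius A T =
     Sup (insert 0 {cmod (A_inner A (blinfun_apply T x) x) | x. A_norm A x = 1})"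


section \<open>Inner product spaces given by a carrier\<close>

text \<open>
  The completion of a quotient that depends on the operator A cannot be a type, so it is
  described by explicit operations on a carrier set. Operators are functions from the carrier to
  itself that are undefined outside it, so that they are determined by their action.
\<close>

record 'v inner_space =
  vcarrier :: "'v set"
  vadd :: "'v \<Rightarrow> 'v \<Rightarrow> 'v"
  vscale :: "complex \<Rightarrow> 'v \<Rightarrow> 'v"
  vinner :: "'v \<Rightarrow> 'v \<Rightarrow> complex"

definition vnorm :: "'v inner_space \<Rightarrow> 'v \<Rightarrow> real" where
  "vnorm V x = sqrt (Re (vinner V x x))"

definition ops :: "'v inner_space \<Rightarrow> ('v \<Rightarrow> 'v) set" where
  "ops V = {F \<in> vcarrier V \<rightarrow>\<^sub>E vcarrier V.
     (\<forall>x\<in>vcarrier V. \<forall>y\<in>vcarrier V. F (vadd V x y) = vadd V (F x) (F y)) \<and>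
     (\<forall>c. \<forall>x\<in>vcarrier V. F (vscale V c x) = vscale V c (F x)) \<and>
     (\<exists>K. \<forall>x\<in>vcarrier V. vnorm V (F x) \<le> K * vnorm V x)}"

definition op_norm :: "'v inner_space \<Rightarrow> ('v \<Rightarrow> 'v) \<Rightarrow> real" where
  "op_norm V F = Sup (insert 0 {vnorm V (F x) | x. x \<in> vcarrier V \<and> vnorm V x = 1})"

definition op_add :: "'v inner_space \<Rightarrow> ('v \<Rightarrow> 'v) \<Rightarrow> ('v \<Rightarrow> 'v) \<Rightarrow> 'v \<Rightarrow> 'v" where
  "op_add V F G = (\<lambda>x\<in>vcarrier V. vadd V (F x) (G x))"

definition op_scale :: "'v inner_space \<Rightarrow> complex \<Rightarrow> ('v \<Rightarrow> 'v) \<Rightarrow> 'v \<Rightarrow> 'v" where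
  "op_scale V c F = (\<lambda>x\<in>vcarrier V. vscale V c (F x))"

definition op_id :: "'v inner_space \<Rightarrow> 'v \<Rightarrow> 'v" where
  "op_id V = (\<lambda>x\<in>vcarrier V. x)"

text \<open>Evaluation of a real polynomial at an operator, by Horner's scheme.\<close>

definition op_poly :: "'v inner_space \<Rightarrow> real poly \<Rightarrow> ('v \<Rightarrow> 'v) \<Rightarrow> 'v \<Rightarrow> 'v" where
  "op_poly V p F =
     foldr (\<lambda>a G. op_add V (op_scale V (complex_of_real a) (op_id V)) (compose (vcarrier V) F G))
       (coeffs p) (op_scale V 0 (op_id V))"

text \<open>
  Real powers of a positive operator by continuous functional calculus: the spectrum of F is
  contained in the interval from 0 to the norm of F, and the power is the limit in operator norm
  of p(F) as the polynomials p approximate the power function uniformly on that interval.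
\<close>

definition op_powr :: "'v inner_space \<Rightarrow> ('v \<Rightarrow> 'v) \<Rightarrow> real \<Rightarrow> 'v \<Rightarrow> 'v" where
  "op_powr V F r =
     (THE Q. Q \<in> ops V \<and>
        (\<forall>p. uniform_limit {0..op_norm V F} (\<lambda>n. poly (p n)) (\<lambda>t. t powr r) sequentially \<longrightarrow>
             (\<lambda>n. op_norm V (op_add V (op_poly V (p n) F) (op_scale V (- 1) Q))) \<longlonglongrightarrow> 0))"


section \<open>The Hilbert space completion of H modulo the kernel of A\<close>

text \<open>
  The quotient and the completion are taken in one step: Cauchy sequences for the seminorm,
  modulo sequences whose seminorm tends to 0. The vectors of H enter as constant sequences,
  and two of them are identified iff they differ by an element of the kernel of A.
\<close>

definition A_Cauchy :: "('h::complex_inner \<Rightarrow>\<^sub>L 'h) \<Rightarrow> (nat \<Rightarrow> 'h) set" where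
  "A_Cauchy A = {u. \<forall>e>0. \<exists>N. \<forall>m\<ge>N. \<forall>n\<ge>N. A_norm A (u m - u n) < e}"

definition A_equiv :: "('h::complex_inner \<Rightarrow>\<^sub>L 'h) \<Rightarrow> ((nat \<Rightarrow> 'h) \<times> (nat \<Rightarrow> 'h)) set" where
  "A_equiv A =
     {(u, v). u \<in> A_Cauchy A \<and> v \<in> A_Cauchy A \<and> (\<lambda>n. A_norm A (u n - v n)) \<longlonglongrightarrow> 0}"

definition A_class :: "('h::complex_inner \<Rightarrow>\<^sub>L 'h) \<Rightarrow> (nat \<Rightarrow> 'h) \<Rightarrow> (nat \<Rightarrow> 'h) set" where
  "A_class A u = A_equiv A `` {u}"

definition rep :: "(nat \<Rightarrow> 'h) set \<Rightarrow> nat \<Rightarrow> 'h" where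
  "rep U = (SOME u. u \<in> U)"

definition A_completion :: "('h::complex_inner \<Rightarrow>\<^sub>L 'h) \<Rightarrow> (nat \<Rightarrow> 'h) set inner_space" where
  "A_completion A =
     \<lparr>vcarrier = A_Cauchy A // A_equiv A,
      vadd = (\<lambda>U V. A_class A (\<lambda>n. rep U n + rep V n)),
      vscale = (\<lambda>c U. A_class A (\<lambda>n. c *\<^sub>C rep U n)),
      vinner = (\<lambda>U V. lim (\<lambda>n. A_inner A (rep U n) (rep V n)))\<rparr>"

definition induced_op ::
  "('h::complex_inner \<Rightarrow>\<^sub>L 'h) \<Rightarrow> ('h \<Rightarrow>\<^sub>L 'h) \<Rightarrow> (nat \<Rightarrow> 'h) set \<Rightarrow> (nat \<Rightarrow> 'h) set" where
  "induced_op A S =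
     (\<lambda>U\<in>vcarrier (A_completion A). A_class A (\<lambda>n. blinfun_apply S (rep U n)))"

definition A_norm_sum_powr ::
  "('h::complex_inner \<Rightarrow>\<^sub>L 'h) \<Rightarrow> ('h \<Rightarrow>\<^sub>L 'h) \<Rightarrow> ('h \<Rightarrow>\<^sub>L 'h) \<Rightarrow> real \<Rightarrow> real" where
  "A_norm_sum_powr A S R r =
     op_norm (A_completion A)
       (op_add (A_completion A)
          (op_powr (A_completion A) (induced_op A S) r)
          (op_powr (A_completion A) (induced_op A R) r))"

end

theory Submission
  imports Defs "HOL-Computational_Algebra.Fundamental_Theorem_Algebra"
begin

text \<open>
  Write \<open>T\<close> for the off-diagonal block operator, \<open>T\<^sup>#\<close> for its adjoint and let \<open>z\<close> be a unit
  vector, all with respect to the semi-inner product on the direct sum. Buzano's inequality gives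
  \<open>2\<bar>\<langle>Tz, z\<rangle>\<bar>\<^sup>2 \<le> a\<^sub>0 + b\<^sub>0\<close> with \<open>a\<^sub>0 = \<parallel>Tz\<parallel>\<parallel>T\<^sup>#z\<parallel>\<close> and \<open>b\<^sub>0 = \<bar>\<langle>T\<^sup>2z, z\<rangle>\<bar> \<le> a\<^sub>0\<close>. Here \<open>b\<^sub>0\<close>
  is controlled by the numerical radii of \<open>XY\<close> and \<open>YX\<close>, while the arithmetic-geometric mean
  inequality and McCarthy's inequality \<open>\<langle>Px, x\<rangle>\<^sup>r \<le> \<langle>P\<^sup>rx, x\<rangle>\<close> bound \<open>a\<^sub>0\<^sup>r\<close> by
  \<open>max {\<lambda>\<^sub>r, \<mu>\<^sub>r} / 2\<close>. Convexity of the power function gives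
  \<open>\<bar>\<langle>Tz, z\<rangle>\<bar>\<^sup>4\<^sup>r \<le> ((a\<^sub>0\<^sup>r + b\<^sub>0\<^sup>r) / 2)\<^sup>2\<close>, and \<open>b\<^sub>0 \<le> a\<^sub>0\<close> lets part of \<open>b\<^sub>0\<^sup>2\<^sup>r\<close> be traded for
  the two terms on the right-hand side.

  The powers of \<open>P\<close> in the completion rest on the bound \<open>\<parallel>p(P)\<parallel> \<le> sup \<bar>p\<bar>\<close> over \<open>[0, \<parallel>P\<parallel>]\<close> for
  real polynomials, which needs no completeness: if \<open>p - m\<close> has no roots in that interval, factoring
  it over the complex numbers shows that \<open>p(P) - m\<close> is bounded below.
\<close>

section \<open>Semi-inner products\<close>

lemma scaleC_right_zero [simp]: "c *\<^sub>C (0::'a::complex_inner) = 0"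
  using scaleC_add_right[of c 0 0] by simp

lemma scaleC_zero_left [simp]: "0 *\<^sub>C (x::'a::complex_inner) = 0"
  using scaleC_add_left[of 0 0 x] by simp

lemma scaleC_one [simp]: "1 *\<^sub>C (x::'a::complex_inner) = x"
  using scaleR_scaleC[of 1 x] by simp

lemma scaleC_minus_one: "(- 1) *\<^sub>C (x::'a::complex_inner) = - x"
  using scaleR_scaleC[of "- 1" x] by simp

lemma scaleC_minus_right: "c *\<^sub>C (- x::'a::complex_inner) = - (c *\<^sub>C x)"
  using scaleC_add_right[of c x "- x"] by (simp add: eq_neg_iff_add_eq_0 add.commute)

lemma scaleC_diff_right: "c *\<^sub>C (x - y::'a::complex_inner) = c *\<^sub>C x - c *\<^sub>C y"
  using scaleC_add_right[of c x "- y"] by (simp add: scaleC_minus_right)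

text \<open>A function of the form, because several forms occur: \<open>cinner\<close>,
  \<open>A_inner A\<close>, its analogue on the direct sum, and the form
  \<open>\<lambda>x y. B (G x) y\<close> of a positive map \<open>G\<close>.\<close>

definition seminorm_of :: "('h \<Rightarrow> 'h \<Rightarrow> complex) \<Rightarrow> 'h \<Rightarrow> real" where
  "seminorm_of B x = sqrt (Re (B x x))"

text \<open>Definiteness is left out, so that \<open>A_inner A\<close> is an instance even if
  \<open>A\<close> has a nontrivial kernel.\<close>

locale semi_inner =
  fixes B :: "'h::complex_inner \<Rightarrow> 'h \<Rightarrow> complex"
  assumes add_left: "B (x + y) z = B x z + B y z"
    and scale_left: "B (c *\<^sub>C x) y = c * B x y"
    and conj_sym: "B y x = cnj (B x y)"
    and nonneg: "0 \<le> Re (B x x)"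
begin

abbreviation nrm :: "'h \<Rightarrow> real" where "nrm \<equiv> seminorm_of B"

lemma add_right: "B x (y + z) = B x y + B x z"
  by (subst (1 2 3) conj_sym) (simp add: add_left)

lemma scale_right: "B x (c *\<^sub>C y) = cnj c * B x y"
  by (subst (1 2) conj_sym) (simp add: scale_left)

lemma zero_left [simp]: "B 0 y = 0"
  using add_left[of 0 0 y] by simp

lemma zero_right [simp]: "B x 0 = 0"
  using add_right[of x 0 0] by simp

lemma minus_left: "B (- x) y = - B x y"
  using add_left[of x "- x" y] by (simp add: eq_neg_iff_add_eq_0 add.commute)

lemma minus_right: "B x (- y) = - B x y"
  using add_right[of x y "- y"] by (simp add: eq_neg_iff_add_eq_0 add.commute)

lemma diff_left: "B (x - y) z = B x z - B y z"
  using add_left[of x "- y" z] by (simp add: minus_left)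

lemma diff_right: "B x (y - z) = B x y - B x z"
  using add_right[of x y "- z"] by (simp add: minus_right)

lemma Im_self [simp]: "Im (B x x) = 0"
  using arg_cong[OF conj_sym[of x x], of Im] by simp

lemma self_eq: "B x x = complex_of_real ((nrm x)\<^sup>2)"
  by (simp add: complex_eq_iff seminorm_of_def nonneg)

lemma nrm_sq: "(nrm x)\<^sup>2 = Re (B x x)"
  by (simp add: seminorm_of_def nonneg)

lemma nrm_nonneg [simp]: "0 \<le> nrm x"
  by (simp add: seminorm_of_def nonneg)

lemma nrm_zero [simp]: "nrm 0 = 0"
  by (simp add: seminorm_of_def)

lemma nrm_scale: "nrm (c *\<^sub>C x) = cmod c * nrm x"
proof -
  have "B (c *\<^sub>C x) (c *\<^sub>C x) = complex_of_real ((cmod c)\<^sup>2) * B x x"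
    unfolding complex_norm_square by (simp add: scale_left scale_right)
  hence "(nrm (c *\<^sub>C x))\<^sup>2 = (cmod c * nrm x)\<^sup>2"
    unfolding nrm_sq power_mult_distrib by simp
  thus ?thesis by (simp add: power2_eq_iff_nonneg)
qed

lemma nrm_uminus: "nrm (- x) = nrm x"
  using nrm_scale[of "- 1" x] by (simp add: scaleC_minus_one)

lemma nrm_minus_commute: "nrm (x - y) = nrm (y - x)"
  using nrm_uminus[of "x - y"] by simp

text \<open>Expand the nonnegative value of the form at \<open>x - z y\<close> for
  \<open>z = t B x y\<close> with real \<open>t\<close>, then choose \<open>t\<close>. Since the
  form may be degenerate, \<open>nrm y = 0\<close> calls for a choice of its own.\<close>

lemma Cauchy_Schwarz: "cmod (B x y) \<le> nrm x * nrm y"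
proof -
  have key: "0 \<le> (nrm x)\<^sup>2 - 2 * t * (cmod (B x y))\<^sup>2 + t\<^sup>2 * (cmod (B x y))\<^sup>2 * (nrm y)\<^sup>2" for t :: real
  proof -
    let ?z = "complex_of_real t * B x y"
    have "0 \<le> Re (B (x - ?z *\<^sub>C y) (x - ?z *\<^sub>C y))" by (rule nonneg)
    also have "B (x - ?z *\<^sub>C y) (x - ?z *\<^sub>C y)
        = B x x - cnj ?z * B x y - ?z * B y x + ?z * cnj ?z * B y y"
      by (simp add: diff_left diff_right scale_left scale_right algebra_simps)
    also have "\<dots> = complex_of_real ((nrm x)\<^sup>2 - 2 * t * (cmod (B x y))\<^sup>2
        + t\<^sup>2 * (cmod (B x y))\<^sup>2 * (nrm y)\<^sup>2)"
      unfolding of_real_add of_real_diff of_real_mult complex_norm_square self_eq[symmetric]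
        conj_sym[of y x]
      by (simp add: complex_norm_square power2_eq_square algebra_simps)
    finally show ?thesis by simp
  qed
  let ?m = "(cmod (B x y))\<^sup>2"
  have "?m \<le> (nrm x)\<^sup>2 * (nrm y)\<^sup>2"
  proof (cases "nrm y = 0")
    case True
    show ?thesis
    proof (rule ccontr)
      assume "\<not> ?thesis"
      hence m: "?m > 0" using True by simp
      \<comment> \<open>For \<open>nrm y = 0\<close> the expression is affine in \<open>t\<close>
        with negative slope, so a large \<open>t\<close> makes it negative.\<close>
      have "0 \<le> (nrm x)\<^sup>2 - 2 * (((nrm x)\<^sup>2 + 1) / ?m) * ?m"
        using key[of "((nrm x)\<^sup>2 + 1) / ?m"] True by simp
      also have "\<dots> = - (nrm x)\<^sup>2 - 2" using m by simp
      finally show False using zero_le_power2[of "nrm x"] by linarith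
    qed
  next
    case False
    hence p: "(nrm y)\<^sup>2 > 0" by simp
    \<comment> \<open>The quadratic in \<open>t\<close> is minimal at
      \<open>t = 1 / (nrm y)\<^sup>2\<close>.\<close>
    have "0 \<le> (nrm x)\<^sup>2 - 2 * (1 / (nrm y)\<^sup>2) * ?m + (1 / (nrm y)\<^sup>2)\<^sup>2 * ?m * (nrm y)\<^sup>2"
      by (rule key)
    also have "\<dots> = (nrm x)\<^sup>2 - ?m / (nrm y)\<^sup>2"
      using p by (simp add: field_simps power2_eq_square)
    finally show ?thesis using p by (simp add: field_simps)
  qed
  hence "?m \<le> (nrm x * nrm y)\<^sup>2" by (simp only: power_mult_distrib)
  thus ?thesis by (rule power2_le_imp_le) simp
qed

lemma nrm_triangle: "nrm (x + y) \<le> nrm x + nrm y"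
proof -
  have "(nrm (x + y))\<^sup>2 = (nrm x)\<^sup>2 + (nrm y)\<^sup>2 + 2 * Re (B x y)"
    unfolding nrm_sq by (simp add: add_left add_right conj_sym[of y x])
  also have "\<dots> \<le> (nrm x)\<^sup>2 + (nrm y)\<^sup>2 + 2 * (nrm x * nrm y)"
    using Cauchy_Schwarz[of x y] complex_Re_le_cmod[of "B x y"] by linarith
  also have "\<dots> = (nrm x + nrm y)\<^sup>2" by (simp add: power2_eq_square algebra_simps)
  finally show ?thesis by (rule power2_le_imp_le) simp
qed

lemma nrm_triangle_diff: "nrm (x - z) \<le> nrm (x - y) + nrm (y - z)"
  using nrm_triangle[of "x - y" "y - z"] by simp

lemma nrm_reverse_triangle: "\<bar>nrm x - nrm y\<bar> \<le> nrm (x - y)"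
  using nrm_triangle[of "x - y" y] nrm_triangle[of "y - x" x] by (simp add: nrm_minus_commute)

text \<open>The vector \<open>2\<langle>a,e\<rangle>e - a\<close> is a reflection of \<open>a\<close>, so it has the same seminorm.\<close>

lemma Buzano:
  assumes e: "nrm e = 1"
  shows "2 * cmod (B a e * B e b) \<le> nrm a * nrm b + cmod (B a b)"
proof -
  let ?v = "(2 * B a e) *\<^sub>C e - a"
  have "B ?v ?v = B a a"
    using e by (simp add: diff_left diff_right scale_left scale_right self_eq[of e]
        conj_sym[of e a] algebra_simps)
  hence nv: "nrm ?v = nrm a" by (simp add: seminorm_of_def)
  have "2 * (B a e * B e b) = B ?v b + B a b"
    by (simp add: diff_left scale_left)
  hence "cmod (2 * (B a e * B e b)) \<le> cmod (B ?v b) + cmod (B a b)"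
    by (metis norm_triangle_ineq)
  thus ?thesis using Cauchy_Schwarz[of ?v b] by (simp add: nv norm_mult)
qed

end

section \<open>Polynomials of positive operators\<close>

text \<open>Horner's scheme on \<open>H\<close> itself, the counterpart of \<open>op_poly\<close> on
  the completion. Complex coefficients are allowed so that polynomials can be split into linear
  factors.\<close>

definition op_eval :: "('h \<Rightarrow> 'h) \<Rightarrow> complex poly \<Rightarrow> 'h \<Rightarrow> 'h::complex_inner" where
  "op_eval S p = fold_coeffs (\<lambda>a g x. a *\<^sub>C x + S (g x)) p (\<lambda>x. 0)"

abbreviation of_real_poly :: "real poly \<Rightarrow> complex poly" where
  "of_real_poly \<equiv> map_poly complex_of_real"

lemma of_real_poly_diff: "of_real_poly (p - q) = of_real_poly p - of_real_poly q"
  by (intro poly_eqI) (simp add: coeff_map_poly)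

lemma of_real_poly_mult: "of_real_poly (p * q) = of_real_poly p * of_real_poly q"
  by (intro poly_eqI) (simp add: coeff_map_poly coeff_mult)

lemma of_real_poly_const: "of_real_poly [:c:] = [:complex_of_real c:]"
  by (simp add: map_poly_pCons)

lemma poly_of_real_poly: "poly (of_real_poly p) (complex_of_real t) = complex_of_real (poly p t)"
  by (induction p) (simp_all add: map_poly_pCons)

context semi_inner
begin

text \<open>Cauchy-Schwarz for the form \<open>\<langle>Gx, y\<rangle>\<close> at the pair \<open>x, Gx\<close>.\<close>

lemma pos_image_bound:
  assumes add: "\<And>x y. G (x + y) = G x + G y" and scale: "\<And>c x. G (c *\<^sub>C x) = c *\<^sub>C G x"
    and sym: "\<And>x y. B (G x) y = B x (G y)" and pos: "\<And>x. 0 \<le> Re (B (G x) x)"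
    and le: "\<And>x. Re (B (G x) x) \<le> K * (nrm x)\<^sup>2"
  shows "(nrm (G x))\<^sup>2 \<le> K * Re (B (G x) x)"
proof -
  interpret G: semi_inner "\<lambda>x y. B (G x) y"
    by unfold_locales (auto simp: add scale add_left scale_left pos intro: trans[OF sym conj_sym])
  let ?b = "Re (B (G x) x)" and ?n = "(nrm (G x))\<^sup>2"
  have "?n \<le> G.nrm x * G.nrm (G x)"
    using G.Cauchy_Schwarz[of x "G x"] by (simp add: self_eq norm_power)
  hence "?n\<^sup>2 \<le> (G.nrm x)\<^sup>2 * (G.nrm (G x))\<^sup>2"
    by (metis power_mono power_mult_distrib zero_le_power2)
  also have "\<dots> = ?b * Re (B (G (G x)) (G x))"
    by (simp add: G.nrm_sq)
  also have "\<dots> \<le> ?b * (K * ?n)"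
    using le[of "G x"] pos[of x] by (rule mult_left_mono)
  finally have *: "?n * ?n \<le> (K * ?b) * ?n"
    by (simp add: power2_eq_square mult_ac)
  show ?thesis
  proof (cases "?n = 0")
    case True
    \<comment> \<open>\<open>K\<close> may be negative only if \<open>x\<close> has seminorm zero,
      and then \<open>?b\<close> vanishes as well.\<close>
    have "0 \<le> K * ?b"
    proof (cases "nrm x = 0")
      case True
      thus ?thesis using le[of x] pos[of x] by simp
    next
      case False
      hence "0 < (nrm x)\<^sup>2" by simp
      hence "0 \<le> K" using le[of x] pos[of x] by (smt (verit) mult_neg_pos)
      thus ?thesis using pos[of x] by simp
    qed
    thus ?thesis using True by simp
  next
    case False
    hence "0 < ?n" by simp
    thus ?thesis using * by (simp only: mult_le_cancel_right)
  qed
qed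

end

text \<open>This is \<open>0 \<le> S \<le> M\<close> in the sense of quadratic forms; the operator
  bound \<open>S_bound\<close> follows from it.\<close>

locale pos_op = semi_inner B for B :: "'h::complex_inner \<Rightarrow> 'h \<Rightarrow> complex" +
  fixes S :: "'h \<Rightarrow> 'h" and M :: real
  assumes S_add: "S (x + y) = S x + S y"
    and S_scale: "S (c *\<^sub>C x) = c *\<^sub>C S x"
    and S_sym: "B (S x) y = B x (S y)"
    and S_nonneg: "0 \<le> Re (B (S x) x)"
    and S_le: "Re (B (S x) x) \<le> M * (nrm x)\<^sup>2"
    and M_nonneg: "0 \<le> M"
begin

lemma S_zero [simp]: "S 0 = 0"
  using S_scale[of 0 0] by simp

lemma S_bound: "nrm (S x) \<le> M * nrm x"
proof -
  have "(nrm (S x))\<^sup>2 \<le> M * Re (B (S x) x)"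
    by (rule pos_image_bound[OF S_add S_scale S_sym S_nonneg S_le])
  also have "\<dots> \<le> M * (M * (nrm x)\<^sup>2)"
    by (intro mult_left_mono S_le M_nonneg)
  also have "\<dots> = (M * nrm x)\<^sup>2" by (simp add: power2_eq_square)
  finally show ?thesis by (rule power2_le_imp_le) (simp add: M_nonneg)
qed

section \<open>Evaluation of polynomials at a positive operator\<close>

abbreviation ev :: "complex poly \<Rightarrow> 'h \<Rightarrow> 'h" where "ev \<equiv> op_eval S"

lemma ev_0 [simp]: "ev 0 x = 0"
  by (simp add: op_eval_def)

lemma ev_pCons [simp]: "ev (pCons a p) x = a *\<^sub>C x + S (ev p x)"
  by (cases "a = 0 \<and> p = 0") (auto simp: op_eval_def)

lemma ev_add: "ev (p + q) x = ev p x + ev q x"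
  by (induction p q rule: poly_induct2) (simp_all add: S_add scaleC_add_left)

lemma ev_smult: "ev (smult c p) x = c *\<^sub>C ev p x"
  by (induction p) (simp_all add: S_scale scaleC_add_right scaleC_scaleC)

lemma ev_diff: "ev (p - q) x = ev p x - ev q x"
  using ev_add[of "p - q" q x] by simp

lemma ev_vec_add: "ev p (x + y) = ev p x + ev p y"
  by (induction p) (simp_all add: S_add scaleC_add_right)

lemma ev_vec_scale: "ev p (c *\<^sub>C x) = c *\<^sub>C ev p x"
  by (induction p) (simp_all add: S_scale scaleC_add_right scaleC_scaleC mult.commute)

lemma ev_mult: "ev (p * q) x = ev p (ev q x)"
  by (induction p) (simp_all add: ev_add ev_smult)

lemma ev_sym: "B (ev (of_real_poly p) x) y = B x (ev (of_real_poly p) y)"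
proof (induction p arbitrary: x y)
  case (pCons a p)
  have "B (S (ev (of_real_poly p) x)) y = B (ev (of_real_poly p) x) (S y)" by (rule S_sym)
  also have "\<dots> = B x (ev (of_real_poly p) (S y))" by (rule pCons.IH)
  \<comment> \<open>The polynomial \<open>[:0, 1:]\<close> evaluates to \<open>S\<close>, so
    \<open>S\<close> commutes with \<open>p(S)\<close> because polynomial multiplication is
    commutative.\<close>
  also have "ev (of_real_poly p) (S y) = ev (of_real_poly p * [:0, 1:]) y"
    unfolding ev_mult by simp
  also have "of_real_poly p * [:0, 1:] = [:0, 1:] * of_real_poly p" by (rule mult.commute)
  also have "ev \<dots> y = S (ev (of_real_poly p) y)"
    unfolding ev_mult by simp
  finally show ?case
    by (simp add: map_poly_pCons add_left add_right scale_left scale_right)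
qed simp

lemma ev_bounded: "\<exists>K\<ge>0. \<forall>x. nrm (ev p x) \<le> K * nrm x"
proof (induction p)
  case 0
  show ?case by (intro exI[of _ 0]) simp
next
  case (pCons a p)
  then obtain K where K: "K \<ge> 0" "\<And>x. nrm (ev p x) \<le> K * nrm x" by blast
  have "nrm (ev (pCons a p) x) \<le> (cmod a + M * K) * nrm x" for x
  proof -
    have "nrm (ev (pCons a p) x) \<le> cmod a * nrm x + nrm (S (ev p x))"
      using nrm_triangle by (simp flip: nrm_scale)
    also have "nrm (S (ev p x)) \<le> M * (K * nrm x)"
      using S_bound[of "ev p x"] K(2)[of x] M_nonneg
      by (meson mult_left_mono order_trans)
    finally show ?thesis by (simp add: algebra_simps)
  qed
  thus ?case using K(1) M_nonneg by (intro exI[of _ "cmod a + M * K"]) simp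
qed

text \<open>For \<open>nrm x = 1\<close> the value of the form at \<open>S x, x\<close> lies in
  \<open>[0, M]\<close>, so the form of \<open>S - z\<close> at \<open>x\<close> has modulus at
  least the distance from \<open>z\<close> to that interval. This distance is the witness for
  \<open>d\<close>.\<close>

lemma resolvent_bounded_below:
  assumes "z \<notin> complex_of_real ` {0..M}"
  obtains d where "0 < d" "\<And>x. d * nrm x \<le> nrm (ev [:- z, 1:] x)"
proof
  let ?I = "complex_of_real ` {0..M}"
  have ne: "?I \<noteq> {}" using M_nonneg by auto
  have "compact ?I"
    by (intro compact_continuous_image continuous_intros) simp
  hence cl: "closed ?I" by (rule compact_imp_closed)
  show "0 < infdist z ?I"
    using assms ne cl infdist_nonneg[of z ?I] in_closed_iff_infdist_zero[OF cl ne, of z] by linarith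
  fix x
  show "infdist z ?I * nrm x \<le> nrm (ev [:- z, 1:] x)"
  proof (cases "nrm x = 0")
    case False
    hence n: "nrm x > 0" using nrm_nonneg[of x] by linarith
    let ?s = "Re (B (S x) x) / (nrm x)\<^sup>2"
    have "Im (B (S x) x) = 0"
      using arg_cong[OF trans[OF S_sym conj_sym], of Im x x] by simp
    hence Sx: "B (S x) x = complex_of_real (?s * (nrm x)\<^sup>2)"
      using n by (simp add: complex_eq_iff)
    have "?s \<in> {0..M}"
      using S_nonneg[of x] S_le[of x] n by (simp add: pos_divide_le_eq)
    hence "infdist z ?I \<le> dist z (complex_of_real ?s)"
      by (intro infdist_le imageI)
    hence "infdist z ?I * (nrm x)\<^sup>2 \<le> cmod (complex_of_real ?s - z) * (nrm x)\<^sup>2"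
      by (intro mult_right_mono) (auto simp: dist_norm norm_minus_commute)
    also have "\<dots> = cmod ((complex_of_real ?s - z) * complex_of_real ((nrm x)\<^sup>2))"
      by (simp add: norm_mult norm_power)
    also have "(complex_of_real ?s - z) * complex_of_real ((nrm x)\<^sup>2) = B (ev [:- z, 1:] x) x"
      using Sx n by (simp add: add_left scale_left self_eq[of x] algebra_simps)
    also have "cmod \<dots> \<le> nrm (ev [:- z, 1:] x) * nrm x" by (rule Cauchy_Schwarz)
    finally show ?thesis using n by (simp add: power2_eq_square)
  qed simp
qed

text \<open>Split off one complex root after another. Each root lies outside \<open>[0, M]\<close>,
  so each linear factor is bounded below, and the lower bounds multiply.\<close>

lemma poly_bounded_below:
  assumes "p \<noteq> 0" "\<And>t. t \<in> {0..M} \<Longrightarrow> poly p (complex_of_real t) \<noteq> 0"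
  shows "\<exists>d>0. \<forall>x. d * nrm x \<le> nrm (ev p x)"
  using assms
proof (induction "degree p" arbitrary: p rule: less_induct)
  case less
  show ?case
  proof (cases "degree p = 0")
    case True
    then obtain a where "p = [:a:]" by (rule degree_eq_zeroE)
    thus ?thesis using less.prems(1) by (intro exI[of _ "cmod a"]) (simp add: nrm_scale)
  next
    case False
    then obtain z where z: "poly p z = 0"
      using fundamental_theorem_of_algebra[of p] constant_degree[of p] by auto
    then obtain q where p: "p = [:- z, 1:] * q" by (auto simp: poly_eq_0_iff_dvd)
    have "q \<noteq> 0" using less.prems(1) p by auto
    hence "degree q < degree p" unfolding p by (subst degree_mult_eq) auto
    moreover have "poly q (complex_of_real t) \<noteq> 0" if "t \<in> {0..M}" for t
      using less.prems(2)[OF that] p by auto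
    ultimately obtain e where e: "e > 0" "\<And>x. e * nrm x \<le> nrm (ev q x)"
      using less.hyps \<open>q \<noteq> 0\<close> by blast
    have "z \<notin> complex_of_real ` {0..M}" using less.prems(2) z by auto
    then obtain d where d: "d > 0" "\<And>x. d * nrm x \<le> nrm (ev [:- z, 1:] x)"
      using resolvent_bounded_below by blast
    have "d * e * nrm x \<le> nrm (ev p x)" for x
    proof -
      have "d * (e * nrm x) \<le> d * nrm (ev q x)" using e d by (intro mult_left_mono) auto
      also have "\<dots> \<le> nrm (ev [:- z, 1:] (ev q x))" by (rule d(2))
      finally show ?thesis unfolding p ev_mult by simp
    qed
    thus ?thesis using d e by (intro exI[of _ "d * e"]) simp
  qed
qed

text \<open>
  If the numerical range of \<open>p(S)\<close> had a negative infimum \<open>m\<close>, then \<open>p(S) - m\<close> would be positive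
  and not bounded below, although \<open>p - m\<close> has no root in \<open>[0, M]\<close>.
\<close>

lemma poly_positive:
  fixes p :: "real poly"
  assumes p: "\<And>t. t \<in> {0..M} \<Longrightarrow> 0 \<le> poly p t"
  shows "0 \<le> Re (B (ev (of_real_poly p) x) x)"
proof (rule ccontr)
  assume neg: "\<not> ?thesis"
  let ?P = "ev (of_real_poly p)"
  let ?W = "{Re (B (?P y) y) | y. nrm y = 1}"
  define m where "m = Inf ?W"
  obtain K where K: "K \<ge> 0" "\<And>x. nrm (?P x) \<le> K * nrm x" using ev_bounded by blast
  have absle: "\<bar>Re (B (?P y) y)\<bar> \<le> K * (nrm y)\<^sup>2" for y
  proof -
    have "\<bar>Re (B (?P y) y)\<bar> \<le> nrm (?P y) * nrm y"
      using Cauchy_Schwarz abs_Re_le_cmod order_trans by blast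
    also have "\<dots> \<le> K * nrm y * nrm y" by (intro mult_right_mono K) simp
    finally show ?thesis by (simp add: power2_eq_square)
  qed
  have bdd: "bdd_below ?W"
  proof (rule bdd_belowI[of _ "- K"])
    fix w assume "w \<in> ?W"
    then obtain y where "w = Re (B (?P y) y)" "nrm y = 1" by blast
    thus "- K \<le> w" using absle[of y] by simp
  qed
  have nx: "nrm x > 0"
    using neg absle[of x] nrm_nonneg[of x] by (cases "nrm x = 0") (auto simp: less_le)
  have quad: "B (?P y) y = complex_of_real ((nrm y)\<^sup>2) * B (?P u) u" and u1: "nrm u = 1"
    if "nrm y > 0" "u = complex_of_real (1 / nrm y) *\<^sub>C y" for y u
    using that by (simp_all add: ev_vec_scale scale_left scale_right nrm_scale norm_divide power2_eq_square)
  have mle: "m * (nrm y)\<^sup>2 \<le> Re (B (?P y) y)" for y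
  proof (cases "nrm y = 0")
    case True
    thus ?thesis using absle[of y] by simp
  next
    case False
    hence n: "nrm y > 0" using nrm_nonneg[of y] by linarith
    define u where "u = complex_of_real (1 / nrm y) *\<^sub>C y"
    have "m \<le> Re (B (?P u) u)"
      unfolding m_def using u1[OF n u_def] by (intro cInf_lower bdd) blast
    hence "m * (nrm y)\<^sup>2 \<le> Re (B (?P u) u) * (nrm y)\<^sup>2"
      by (rule mult_right_mono) simp
    also have "\<dots> = Re (B (?P y) y)" using quad[OF n u_def] by (simp flip: of_real_power)
    finally show ?thesis .
  qed
  have m: "m < 0"
  proof (rule ccontr)
    assume "\<not> m < 0"
    hence "0 \<le> m * (nrm x)\<^sup>2" by simp
    thus False using mle[of x] neg by linarith
  qed
  define q where "q = p - [:m:]"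
  let ?G = "ev (of_real_poly q)"
  have G: "?G y = ?P y - complex_of_real m *\<^sub>C y" for y
    by (simp add: q_def of_real_poly_diff of_real_poly_const ev_diff)
  have Gq: "Re (B (?G y) y) = Re (B (?P y) y) - m * (nrm y)\<^sup>2" for y
    by (simp add: G diff_left scale_left self_eq[of y])
  \<comment> \<open>The form of \<open>p(S) - m\<close> lies between 0 and \<open>K - m\<close>, so
    Cauchy-Schwarz for this form bounds the image by the form.\<close>
  have Gim: "(nrm (?G y))\<^sup>2 \<le> (K - m) * Re (B (?G y) y)" for y
  proof (rule pos_image_bound)
    show "0 \<le> Re (B (?G x) x)" for x using mle[of x] by (simp add: Gq)
    show "Re (B (?G x) x) \<le> (K - m) * (nrm x)\<^sup>2" for x
      using absle[of x] by (simp add: Gq algebra_simps)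
  qed (auto simp: ev_vec_add ev_vec_scale ev_sym)
  have qpos: "poly q t > 0" if "t \<in> {0..M}" for t
    using p[OF that] m by (simp add: q_def)
  have "of_real_poly q \<noteq> 0"
    using qpos[of 0] M_nonneg poly_of_real_poly[of q 0] by auto
  moreover have "poly (of_real_poly q) (complex_of_real t) \<noteq> 0" if "t \<in> {0..M}" for t
    using qpos[OF that] by (simp add: poly_of_real_poly)
  ultimately obtain d where d: "d > 0" "\<And>y. d * nrm y \<le> nrm (?G y)"
    using poly_bounded_below by blast
  have Km: "K - m > 0" using K m by linarith
  have ne: "?W \<noteq> {}" using u1[OF nx refl] by blast
  \<comment> \<open>The margin is chosen so that a unit vector \<open>y\<close> with value that
    close to the infimum has \<open>(nrm (?G y))\<^sup>2 < d\<^sup>2\<close>, against the lower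
    bound \<open>d\<close>.\<close>
  have "Inf ?W < m + d\<^sup>2 / (K - m)" unfolding m_def[symmetric] using d Km by simp
  from cInf_lessD[OF ne this] obtain y
    where y: "nrm y = 1" "Re (B (?P y) y) < m + d\<^sup>2 / (K - m)" by auto
  have "d\<^sup>2 \<le> (nrm (?G y))\<^sup>2" using d(2)[of y] y d(1) by (intro power_mono) auto
  also have "\<dots> \<le> (K - m) * (Re (B (?P y) y) - m)" using Gim[of y] y by (simp add: Gq)
  also have "\<dots> < (K - m) * (d\<^sup>2 / (K - m))"
    using y(2) Km by (intro mult_strict_left_mono) auto
  also have "\<dots> = d\<^sup>2" using Km by simp
  finally show False by simp
qed

text \<open>Apply \<open>poly_positive\<close> to \<open>c\<^sup>2 - p\<^sup>2\<close>. As
  \<open>p(S)\<close> is symmetric, the form of \<open>p(S)\<^sup>2\<close> at \<open>x\<close> is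
  the square of the seminorm of \<open>p(S) x\<close>.\<close>

lemma poly_norm_le:
  fixes p :: "real poly"
  assumes p: "\<And>t. t \<in> {0..M} \<Longrightarrow> \<bar>poly p t\<bar> \<le> c"
  shows "nrm (ev (of_real_poly p) x) \<le> c * nrm x"
proof -
  let ?P = "ev (of_real_poly p)"
  have c: "0 \<le> c" using p[of 0] M_nonneg by force
  have "0 \<le> Re (B (ev (of_real_poly ([:c\<^sup>2:] - p * p)) x) x)"
  proof (rule poly_positive)
    fix t assume "t \<in> {0..M}"
    hence "\<bar>poly p t\<bar>\<^sup>2 \<le> c\<^sup>2" using p by (intro power_mono) auto
    thus "0 \<le> poly ([:c\<^sup>2:] - p * p) t" by (simp add: power2_eq_square)
  qed
  also have "B (ev (of_real_poly ([:c\<^sup>2:] - p * p)) x) x = complex_of_real (c\<^sup>2) * B x x - B (?P x) (?P x)"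
    by (simp add: of_real_poly_diff of_real_poly_mult of_real_poly_const ev_diff ev_mult
        diff_left scale_left ev_sym[of p "?P x" x])
  finally have "(nrm (?P x))\<^sup>2 \<le> (c * nrm x)\<^sup>2"
    unfolding nrm_sq power_mult_distrib by (simp flip: of_real_power)
  thus ?thesis by (rule power2_le_imp_le) (simp add: c)
qed

end

section \<open>Adjoints with respect to a positive operator\<close>

interpretation cinner: semi_inner "cinner :: 'h::complex_inner \<Rightarrow> 'h \<Rightarrow> complex"
proof
  fix x y z :: 'h and c :: complex
  show "cinner (x + y) z = cinner x z + cinner y z" by (rule cinner_add_left)
  show "cinner (c *\<^sub>C x) y = c * cinner x y" by (rule cinner_scaleC_left)
  show "cinner y x = cnj (cinner x y)" by (rule cinner_commute)
  show "0 \<le> Re (cinner x x)" by (simp flip: inner_eq_Re_cinner)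
qed

lemma norm_eq_seminorm_cinner: "norm x = seminorm_of cinner x"
  by (simp add: norm_eq_sqrt_inner inner_eq_Re_cinner seminorm_of_def)

text \<open>Lets an identity between real inner products be upgraded to the complex one by rotating
  the first argument.\<close>

lemma Im_cinner: "Im (cinner x y) = inner ((- \<i>) *\<^sub>C x) y"
  by (simp add: inner_eq_Re_cinner cinner.scale_left)

lemma cinner_right_eqI:
  assumes "\<And>x. cinner x a = cinner x b"
  shows "a = b"
proof -
  have "inner (a - b) (a - b) = 0"
    using assms[of "a - b"] by (simp add: inner_eq_Re_cinner cinner.diff_right)
  thus ?thesis by simp
qed

lemma bounded_linear_scaleC: "bounded_linear (\<lambda>x::'h::complex_inner. c *\<^sub>C x)"
proof (rule bounded_linear_intro[where K = "cmod c"])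
  show "c *\<^sub>C (r *\<^sub>R x) = r *\<^sub>R c *\<^sub>C x" for r and x :: 'h
    by (simp add: scaleR_scaleC scaleC_scaleC mult.commute)
qed (simp_all add: scaleC_add_right norm_eq_seminorm_cinner cinner.nrm_scale mult.commute)

section \<open>Orthogonal decomposition and the Riesz representation in real Hilbert spaces\<close>

lemma closest_point_in_closed_subspace:
  fixes N :: "'h::{real_inner, complete_space} set"
  assumes "closed N" "subspace N"
  shows "\<exists>y\<in>N. \<forall>z\<in>N. inner (x - y) z = 0"
proof -
  let ?D = "(\<lambda>y. (norm (x - y))\<^sup>2) ` N"
  define d where "d = Inf ?D"
  have "0 \<in> N" using assms(2) by (rule subspace_0)
  hence ne: "?D \<noteq> {}" by blast
  have bdd: "bdd_below ?D" by (rule bdd_belowI[of _ 0]) auto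
  have dle: "d \<le> (norm (x - y))\<^sup>2" if "y \<in> N" for y
    unfolding d_def using that bdd by (intro cInf_lower) auto
  have "\<exists>y\<in>N. (norm (x - y))\<^sup>2 < d + inverse (real (Suc n))" for n
    using cInf_lessD[OF ne, of "d + inverse (real (Suc n))"] unfolding d_def by auto
  then obtain y where y: "\<And>n. y n \<in> N" "\<And>n. (norm (x - y n))\<^sup>2 < d + inverse (real (Suc n))"
    by metis
  \<comment> \<open>Parallelogram identity: the midpoint of \<open>y n\<close> and
    \<open>y m\<close> lies in \<open>N\<close>, so its squared distance from \<open>x\<close> is at
    least \<open>d\<close>. Hence a minimizing sequence is Cauchy.\<close>
  have par: "(norm (y n - y m))\<^sup>2 \<le> 2 * inverse (real (Suc n)) + 2 * inverse (real (Suc m))" for n m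
  proof -
    have "(1/2) *\<^sub>R (y n + y m) \<in> N"
      using y(1) assms(2) by (intro subspace_scale subspace_add)
    from dle[OF this] have "4 * d \<le> 4 * (norm (x - (1/2) *\<^sub>R (y n + y m)))\<^sup>2" by simp
    also have "\<dots> = 2 * (norm (x - y n))\<^sup>2 + 2 * (norm (x - y m))\<^sup>2 - (norm (y n - y m))\<^sup>2"
      by (simp add: power2_norm_eq_inner inner_commute algebra_simps)
    finally show ?thesis using y(2)[of n] y(2)[of m] by linarith
  qed
  have "Cauchy y"
  proof (rule metric_CauchyI)
    fix e :: real assume e: "0 < e"
    then obtain k where k: "inverse (real (Suc k)) < e\<^sup>2 / 4"
      using reals_Archimedean[of "e\<^sup>2 / 4"] by auto
    have "dist (y m) (y n) < e" if "m \<ge> k" "n \<ge> k" for m n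
    proof -
      have "inverse (real (Suc j)) \<le> inverse (real (Suc k))" if "j \<ge> k" for j
        using that by (intro le_imp_inverse_le) auto
      from this[OF \<open>m \<ge> k\<close>] this[OF \<open>n \<ge> k\<close>]
      have "(norm (y m - y n))\<^sup>2 < e\<^sup>2" using par[of m n] k by linarith
      thus ?thesis unfolding dist_norm by (rule power2_less_imp_less) (use e in simp)
    qed
    thus "\<exists>M. \<forall>m\<ge>M. \<forall>n\<ge>M. dist (y m) (y n) < e" by blast
  qed
  then obtain l where l: "y \<longlonglongrightarrow> l" using Cauchy_convergent convergentD by blast
  have lN: "l \<in> N" using closed_sequentially[OF assms(1)] y(1) l by blast
  have "(\<lambda>n. (norm (x - y n))\<^sup>2) \<longlonglongrightarrow> (norm (x - l))\<^sup>2" by (intro tendsto_intros l)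
  moreover have "(\<lambda>n. d + inverse (real (Suc n))) \<longlonglongrightarrow> d + 0"
    by (intro tendsto_intros LIMSEQ_inverse_real_of_nat)
  ultimately have ld: "(norm (x - l))\<^sup>2 \<le> d"
    using y(2) by (intro LIMSEQ_le) (auto intro: less_imp_le)
  have "inner (x - l) z = 0" if z: "z \<in> N" for z
  proof (cases "z = 0")
    case False
    let ?i = "inner (x - l) z" and ?m = "inner z z"
    have m: "?m > 0" using False by simp
    \<comment> \<open>The coefficient minimizes the distance from \<open>x\<close> along the line
      through \<open>l\<close> in direction \<open>z\<close>. It would lower the squared distance by
      \<open>?i\<^sup>2 / ?m\<close>, so minimality of \<open>l\<close> forces
      \<open>?i = 0\<close>.\<close>
    have "l + (?i / ?m) *\<^sub>R z \<in> N"
      using lN z assms(2) by (intro subspace_add subspace_scale)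
    from order_trans[OF ld dle[OF this]]
    have "0 \<le> (norm (x - l - (?i / ?m) *\<^sub>R z))\<^sup>2 - (norm (x - l))\<^sup>2" by (simp add: algebra_simps)
    also have "\<dots> = (?i / ?m)\<^sup>2 * ?m - 2 * (?i / ?m) * ?i"
      by (simp only: power2_norm_eq_inner)
        (simp add: inner_diff_left inner_diff_right inner_commute power2_eq_square)
    also have "\<dots> = - (?i\<^sup>2 / ?m)" using m by (simp add: field_simps power2_eq_square)
    finally have "?i\<^sup>2 / ?m \<le> 0" by simp
    thus ?thesis using m by (simp add: divide_le_0_iff not_less)
  qed simp
  thus ?thesis using lN by blast
qed

text \<open>Take \<open>e\<close> orthogonal to the kernel of \<open>f\<close> with
  \<open>f e \<noteq> 0\<close>. Since \<open>z - (f z / f e) e\<close> lies in the kernel,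
  \<open>f\<close> is a multiple of the inner product with \<open>e\<close>.\<close>

lemma Riesz_representation:
  fixes f :: "'h::{real_inner, complete_space} \<Rightarrow> real"
  assumes "bounded_linear f"
  shows "\<exists>w. \<forall>x. f x = inner x w"
proof (cases "\<forall>x. f x = 0")
  case True
  thus ?thesis by (intro exI[of _ 0]) simp
next
  case False
  then obtain x where x: "f x \<noteq> 0" by blast
  interpret f: bounded_linear f by fact
  let ?N = "{x. f x = 0}"
  have "closed ?N"
    using f.continuous_on[OF continuous_on_id, of UNIV]
    by (intro closed_Collect_eq continuous_on_const) (simp add: id_def)
  moreover have "subspace ?N"
    by (simp add: subspace_def f.add f.scaleR f.zero)
  ultimately obtain y where y: "f y = 0" "\<And>z. f z = 0 \<Longrightarrow> inner (x - y) z = 0"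
    using closest_point_in_closed_subspace by blast
  let ?e = "x - y"
  have fe: "f ?e \<noteq> 0" using x y by (simp add: f.diff)
  hence ee: "inner ?e ?e \<noteq> 0" by (auto simp: f.zero)
  have "f z = inner z ((f ?e / inner ?e ?e) *\<^sub>R ?e)" for z
  proof -
    have "inner ?e (z - (f z / f ?e) *\<^sub>R ?e) = 0"
      using fe by (intro y(2)) (simp add: f.diff f.scaleR)
    hence "inner ?e z = f z / f ?e * inner ?e ?e" by (simp add: inner_diff_right)
    thus ?thesis using fe ee by (simp add: inner_commute[of z])
  qed
  thus ?thesis by blast
qed

section \<open>Adjoints and orthogonal projections in complex Hilbert spaces\<close>

lemma bounded_ops_scaleC: "T \<in> bounded_ops \<Longrightarrow> blinfun_apply T (c *\<^sub>C x) = c *\<^sub>C blinfun_apply T x"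
  by (simp add: bounded_ops_def)

lemma bounded_ops_compose: "S \<in> bounded_ops \<Longrightarrow> T \<in> bounded_ops \<Longrightarrow> S o\<^sub>L T \<in> bounded_ops"
  by (simp add: bounded_ops_def)

text \<open>Riesz gives an adjoint for the real inner product. Complex linearity of \<open>T\<close>
  carries the identity from the real parts over to the imaginary parts.\<close>

lemma cadjoint_exists:
  fixes T :: "'h::chilbert_space \<Rightarrow>\<^sub>L 'h"
  assumes T: "T \<in> bounded_ops"
  shows "\<exists>S. \<forall>x y. cinner (blinfun_apply T x) y = cinner x (blinfun_apply S y)"
proof -
  have "\<exists>w. \<forall>x. inner (blinfun_apply T x) y = inner x w" for y
    by (rule Riesz_representation) (intro bounded_linear_intros)
  then obtain s where s: "\<And>x y. inner (blinfun_apply T x) y = inner x (s y)" by metis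
  have eqI: "a = b" if "\<And>x::'h. inner x a = inner x b" for a b
    using that[of "a - b"] inner_diff_right[of "a - b" a b] by simp
  have "bounded_linear s"
  proof (rule bounded_linear_intro[where K = "norm T"])
    show "s (x + y) = s x + s y" for x y
      by (rule eqI) (simp add: inner_add_right flip: s)
    show "s (r *\<^sub>R x) = r *\<^sub>R s x" for r x
      by (rule eqI) (simp flip: s)
    show "norm (s y) \<le> norm y * norm T" for y
    proof (cases "s y = 0")
      case False
      have "norm (s y) * norm (s y) = inner (blinfun_apply T (s y)) y"
        unfolding s power2_norm_eq_inner[symmetric] by (simp add: power2_eq_square)
      also have "\<dots> \<le> norm (blinfun_apply T (s y)) * norm y" by (rule norm_cauchy_schwarz)
      also have "\<dots> \<le> norm T * norm (s y) * norm y"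
        by (intro mult_right_mono norm_blinfun) simp
      finally show ?thesis using False by (simp add: mult_ac)
    qed simp
  qed
  hence S: "blinfun_apply (Blinfun s) = s" by (rule bounded_linear_Blinfun_apply)
  have "cinner (blinfun_apply T x) y = cinner x (s y)" for x y
  proof (rule complex_eqI)
    show "Re (cinner (blinfun_apply T x) y) = Re (cinner x (s y))"
      using s by (simp flip: inner_eq_Re_cinner)
    show "Im (cinner (blinfun_apply T x) y) = Im (cinner x (s y))"
      unfolding Im_cinner s[symmetric] bounded_ops_scaleC[OF T] by (rule refl)
  qed
  thus ?thesis using S by metis
qed

lemma cinner_cadjoint:
  fixes T :: "'h::chilbert_space \<Rightarrow>\<^sub>L 'h"
  assumes "T \<in> bounded_ops"
  shows "cinner (blinfun_apply T x) y = cinner x (blinfun_apply (cadjoint T) y)"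
proof -
  obtain S where S: "\<forall>x y. cinner (blinfun_apply T x) y = cinner x (blinfun_apply S y)"
    using cadjoint_exists[OF assms] by blast
  have "cadjoint T = S"
    unfolding cadjoint_def
  proof (rule the_equality, rule S)
    fix R assume "\<forall>x y. cinner (blinfun_apply T x) y = cinner x (blinfun_apply R y)"
    thus "R = S" using S by (intro blinfun_eqI cinner_right_eqI) metis
  qed
  thus ?thesis using S by simp
qed

text \<open>The real projection is orthogonal in the complex sense too, since \<open>N\<close> is
  closed under multiplication by \<open>\<i>\<close>. Linearity follows from uniqueness of the point
  of \<open>N\<close> with orthogonal residual.\<close>

lemma orthogonal_projection_exists:
  fixes N :: "'h::chilbert_space set"
  assumes N: "closed N" "subspace N" and sc: "\<And>c x. x \<in> N \<Longrightarrow> c *\<^sub>C x \<in> N"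
  shows "\<exists>P\<in>bounded_ops. range (blinfun_apply P) \<subseteq> N
           \<and> (\<forall>x. \<forall>z\<in>N. cinner (x - blinfun_apply P x) z = 0)"
proof -
  obtain p where p: "\<And>x. p x \<in> N" "\<And>x z. z \<in> N \<Longrightarrow> inner (x - p x) z = 0"
    using closest_point_in_closed_subspace[OF N] by metis
  have orth: "cinner (x - p x) z = 0" if "z \<in> N" for x z
  proof -
    have "Im (cinner (x - p x) z) = Re (cinner (x - p x) (\<i> *\<^sub>C z))"
      by (simp add: cinner.scale_right)
    thus ?thesis
      using p(2)[OF that] p(2)[OF sc[OF that, of \<i>]] by (simp add: complex_eq_iff inner_eq_Re_cinner)
  qed
  have uniq: "p x = y" if y: "y \<in> N" "\<And>z. z \<in> N \<Longrightarrow> cinner (x - y) z = 0" for x y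
  proof -
    have d: "y - p x \<in> N" using y(1) p(1) N(2) by (intro subspace_diff)
    have "cinner (y - p x) (y - p x) = cinner (x - p x) (y - p x) - cinner (x - y) (y - p x)"
      by (simp add: cinner.diff_left)
    also have "\<dots> = 0" using orth[OF d] y(2)[OF d] by simp
    finally have "inner (y - p x) (y - p x) = 0" by (simp only: inner_eq_Re_cinner) simp
    thus ?thesis by simp
  qed
  have add: "p (x + y) = p x + p y" for x y
  proof (rule uniq)
    show "p x + p y \<in> N" using p(1) N(2) by (intro subspace_add)
    show "cinner (x + y - (p x + p y)) z = 0" if "z \<in> N" for z
      using orth[OF that, of x] orth[OF that, of y]
      by (simp add: cinner.diff_left cinner.add_left)
  qed
  have scale: "p (c *\<^sub>C x) = c *\<^sub>C p x" for c x
  proof (rule uniq)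
    show "c *\<^sub>C p x \<in> N" using p(1) by (rule sc)
    show "cinner (c *\<^sub>C x - c *\<^sub>C p x) z = 0" if "z \<in> N" for z
      using orth[OF that, of x] by (simp add: cinner.diff_left cinner.scale_left)
  qed
  have le: "norm (p x) \<le> norm x" for x
  proof -
    have "(norm x)\<^sup>2 = (norm (p x))\<^sup>2 + (norm (x - p x))\<^sup>2"
      using p(2)[OF p(1), of x x]
      by (simp add: power2_norm_eq_inner inner_diff_left inner_diff_right inner_commute)
    hence "(norm (p x))\<^sup>2 \<le> (norm x)\<^sup>2" by simp
    thus ?thesis by (rule power2_le_imp_le) simp
  qed
  have "bounded_linear p"
    by (rule bounded_linear_intro[where K = 1]) (simp_all add: add scale scaleR_scaleC le)
  hence "blinfun_apply (Blinfun p) = p" by (rule bounded_linear_Blinfun_apply)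
  thus ?thesis
    using p(1) orth scale by (intro bexI[of _ "Blinfun p"]) (auto simp: bounded_ops_def)
qed

lemma subspace_closure:
  fixes V :: "'v::real_normed_vector set"
  assumes "subspace V"
  shows "subspace (closure V)"
  unfolding subspace_def
proof (intro conjI ballI allI)
  show "0 \<in> closure V"
    using subspace_0[OF assms] closure_subset by blast
  fix x assume "x \<in> closure V"
  then obtain u where u: "\<And>n. u n \<in> V" "u \<longlonglongrightarrow> x" unfolding closure_sequential by blast
  show "c *\<^sub>R x \<in> closure V" for c
    using u by (auto simp: closure_sequential
        intro!: exI[of _ "\<lambda>n. c *\<^sub>R u n"] tendsto_intros subspace_scale[OF assms])
  fix y assume "y \<in> closure V"
  then obtain v where "\<And>n. v n \<in> V" "v \<longlonglongrightarrow> y" unfolding closure_sequential by blast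
  thus "x + y \<in> closure V"
    using u by (auto simp: closure_sequential
        intro!: exI[of _ "\<lambda>n. u n + v n"] tendsto_intros subspace_add[OF assms])
qed

section \<open>The semi-inner product of a positive operator and its adjoints\<close>

locale positive_operator =
  fixes A :: "'h::chilbert_space \<Rightarrow>\<^sub>L 'h"
  assumes positive: "positive_op A"
begin

lemma A_ops: "A \<in> bounded_ops"
  using positive by (simp add: positive_op_def)

lemma A_diag_Im: "Im (cinner (blinfun_apply A x) x) = 0"
  and A_diag_Re: "0 \<le> Re (cinner (blinfun_apply A x) x)"
  using positive by (auto simp: positive_op_def complex_nonneg_Reals_iff)

text \<open>Polarization: the quadratic form of \<open>A\<close> is real at \<open>x + y\<close> and at \<open>x + \<i>y\<close>.\<close>

lemma A_hermitian: "cinner (blinfun_apply A y) x = cnj (cinner (blinfun_apply A x) y)"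
  using A_diag_Im[of "x + y"] A_diag_Im[of "x + \<i> *\<^sub>C y"]
  by (simp add: complex_eq_iff blinfun.add_right bounded_ops_scaleC[OF A_ops] cinner.add_left
      cinner.add_right cinner.scale_left cinner.scale_right A_diag_Im)

sublocale semi_inner "A_inner A"
proof
  show "A_inner A (x + y) z = A_inner A x z + A_inner A y z" for x y z
    by (simp add: A_inner_def blinfun.add_right cinner.add_left)
  show "A_inner A (c *\<^sub>C x) y = c * A_inner A x y" for c x y
    by (simp add: A_inner_def bounded_ops_scaleC[OF A_ops] cinner.scale_left)
  show "A_inner A y x = cnj (A_inner A x y)" for x y
    unfolding A_inner_def by (rule A_hermitian)
  show "0 \<le> Re (A_inner A x x)" for x
    unfolding A_inner_def by (rule A_diag_Re)
qed

lemma A_norm_eq: "A_norm A = nrm"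
  by (simp add: A_norm_def seminorm_of_def fun_eq_iff)

lemma A_selfadjoint: "cinner (blinfun_apply A x) y = cinner x (blinfun_apply A y)"
  by (metis A_hermitian cinner_commute)

text \<open>Existence and uniqueness behind the definite description. Projecting a solution
  \<open>S\<close> onto the closure of the range of \<open>A\<close> leaves \<open>A S\<close>
  unchanged, because \<open>A\<close> vanishes on the orthogonal complement of its range.\<close>

lemma A_adjoint_properties:
  assumes T: "T \<in> A_adjointable A"
  shows "A_adjoint A T \<in> bounded_ops" "A o\<^sub>L A_adjoint A T = cadjoint T o\<^sub>L A"
proof -
  let ?N = "closure (range (blinfun_apply A))"
  let ?Q = "\<lambda>S. S \<in> bounded_ops \<and> A o\<^sub>L S = cadjoint T o\<^sub>L A \<and> range (blinfun_apply S) \<subseteq> ?N"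
  obtain S where S: "S \<in> bounded_ops" "A o\<^sub>L S = cadjoint T o\<^sub>L A"
    using T by (auto simp: A_adjointable_def)
  have sub: "subspace (range (blinfun_apply A))"
    by (intro linear_subspace_image subspace_UNIV) (rule bounded_linear.linear[OF blinfun.bounded_linear_right])
  have sc: "c *\<^sub>C x \<in> ?N" if "x \<in> ?N" for c x
  proof -
    interpret bounded_linear "\<lambda>x::'h. c *\<^sub>C x" by (rule bounded_linear_scaleC)
    have "(\<lambda>x. c *\<^sub>C x) ` range (blinfun_apply A) \<subseteq> range (blinfun_apply A)"
      by (auto simp flip: bounded_ops_scaleC[OF A_ops])
    hence "(\<lambda>x. c *\<^sub>C x) ` ?N \<subseteq> ?N"
      using closure_bounded_linear_image_subset[OF bounded_linear_scaleC, of c "range (blinfun_apply A)"]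
        closure_mono by blast
    thus ?thesis using that by blast
  qed
  obtain P where P: "P \<in> bounded_ops" "range (blinfun_apply P) \<subseteq> ?N"
    "\<And>x z. z \<in> ?N \<Longrightarrow> cinner (x - blinfun_apply P x) z = 0"
    using orthogonal_projection_exists[OF closed_closure subspace_closure[OF sub] sc] by blast
  have AP: "blinfun_apply A (blinfun_apply P x) = blinfun_apply A x" for x
  proof (rule sym, rule cinner_right_eqI)
    fix y
    have "cinner (x - blinfun_apply P x) (blinfun_apply A y) = 0"
      by (rule P(3)) (rule subsetD[OF closure_subset rangeI])
    hence "cinner (blinfun_apply A y) (x - blinfun_apply P x) = 0"
      by (metis cinner_commute complex_cnj_zero)
    hence "cinner y (blinfun_apply A (x - blinfun_apply P x)) = 0"
      unfolding A_selfadjoint .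
    thus "cinner y (blinfun_apply A x) = cinner y (blinfun_apply A (blinfun_apply P x))"
      by (simp add: cinner.diff_right blinfun.diff_right)
  qed
  have "A o\<^sub>L (P o\<^sub>L S) = A o\<^sub>L S"
    by (rule blinfun_eqI) (simp add: AP)
  hence "?Q (P o\<^sub>L S)"
    using S P(1,2) by (auto simp: bounded_ops_compose)
  moreover have "R = R'" if R: "?Q R" and R': "?Q R'" for R R'
  proof (rule blinfun_eqI)
    fix x
    let ?v = "blinfun_apply R x - blinfun_apply R' x"
    have v: "?v \<in> ?N"
      using R R' subspace_closure[OF sub] by (intro subspace_diff) auto
    have "blinfun_apply A (blinfun_apply R x) = blinfun_apply A (blinfun_apply R' x)"
      using R R' by (metis blinfun_apply_blinfun_compose)
    hence Av: "blinfun_apply A ?v = 0" by (simp add: blinfun.diff_right)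
    \<comment> \<open>Since \<open>A ?v = 0\<close>, the vector \<open>?v\<close> is orthogonal to
      the range of \<open>A\<close> and hence to its closure; as \<open>?v\<close> lies in that
      closure, it is 0.\<close>
    have "range (blinfun_apply A) \<subseteq> {z. inner ?v z = 0}"
      using Av by (auto simp: inner_eq_Re_cinner simp flip: A_selfadjoint)
    moreover have "closed {z. inner ?v z = 0}"
      by (intro closed_Collect_eq continuous_intros)
    ultimately have "?N \<subseteq> {z. inner ?v z = 0}" by (rule closure_minimal)
    thus "blinfun_apply R x = blinfun_apply R' x" using v by auto
  qed
  ultimately have "\<exists>!R. ?Q R" by (intro ex_ex1I) (rule exI)
  from theI'[OF this] have "?Q (A_adjoint A T)" unfolding A_adjoint_def .
  thus "A_adjoint A T \<in> bounded_ops" "A o\<^sub>L A_adjoint A T = cadjoint T o\<^sub>L A" by blast+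
qed

lemma A_inner_adjoint:
  assumes T: "T \<in> A_adjointable A"
  shows "A_inner A (blinfun_apply T x) y = A_inner A x (blinfun_apply (A_adjoint A T) y)"
proof -
  have "T \<in> bounded_ops" using T by (simp add: A_adjointable_def)
  hence "A_inner A (blinfun_apply T x) y = cinner x (blinfun_apply (cadjoint T) (blinfun_apply A y))"
    by (simp add: A_inner_def A_selfadjoint cinner_cadjoint)
  also have "\<dots> = cinner x (blinfun_apply A (blinfun_apply (A_adjoint A T) y))"
    using A_adjoint_properties(2)[OF T] by (metis blinfun_apply_blinfun_compose)
  finally show ?thesis by (simp add: A_inner_def A_selfadjoint)
qed

lemma A_norm_le_norm: "nrm x \<le> sqrt (norm A) * norm x"
proof -
  have "Re (A_inner A x x) \<le> norm (blinfun_apply A x) * norm x"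
    unfolding A_inner_def by (simp only: inner_eq_Re_cinner[symmetric] norm_cauchy_schwarz)
  also have "\<dots> \<le> norm A * norm x * norm x" by (intro mult_right_mono norm_blinfun) simp
  also have "\<dots> = norm A * (norm x)\<^sup>2" by (simp add: power2_eq_square)
  finally have "sqrt (Re (A_inner A x x)) \<le> sqrt (norm A * (norm x)\<^sup>2)" by (rule real_sqrt_le_mono)
  thus ?thesis by (simp add: seminorm_of_def real_sqrt_mult)
qed

text \<open>
  Since \<open>\<parallel>G\<^sup>jx\<parallel>\<^sub>A\<close> is log-convex in \<open>j\<close>, it grows at least like the powers of
  \<open>\<parallel>Gx\<parallel>\<^sub>A / \<parallel>x\<parallel>\<^sub>A\<close>, whereas it is at most of the order of the powers of \<open>\<parallel>G\<parallel>\<close>.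
\<close>

lemma A_symmetric_bounded:
  assumes sym: "\<And>x y. A_inner A (blinfun_apply G x) y = A_inner A x (blinfun_apply G y)"
  shows "nrm (blinfun_apply G x) \<le> (norm G + 1) * nrm x"
proof (rule ccontr)
  assume contra: "\<not> ?thesis"
  define a where "a j = nrm ((blinfun_apply G ^^ j) x)" for j
  \<comment> \<open>The summand 1 keeps the reference growth rate positive even for
    \<open>G = 0\<close>, so that it can be divided by.\<close>
  have K: "norm G + 1 > 0" by (simp add: add_nonneg_pos)
  have sq: "(nrm (blinfun_apply G y))\<^sup>2 \<le> nrm y * nrm (blinfun_apply G (blinfun_apply G y))" for y
    unfolding nrm_sq sym using Cauchy_Schwarz complex_Re_le_cmod order_trans by blast
  have n: "nrm x > 0"
  proof (rule ccontr)
    assume "\<not> 0 < nrm x"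
    hence "nrm x = 0" using nrm_nonneg[of x] by linarith
    thus False using sq[of x] contra by simp
  qed
  let ?q = "nrm (blinfun_apply G x) / nrm x"
  have q: "?q > norm G + 1" using contra n by (simp add: field_simps)
  hence q0: "?q > 0" using K by linarith
  have step: "0 < a j \<and> ?q * a j \<le> a (Suc j)" for j
  proof (induction j)
    case 0
    show ?case using n by (simp add: a_def)
  next
    case (Suc j)
    have pos: "0 < a (Suc j)"
      using Suc q0 by (meson less_le_trans mult_pos_pos)
    have "a j * (?q * a (Suc j)) \<le> a (Suc j) * a (Suc j)"
      using Suc pos mult_right_mono[of "?q * a j" "a (Suc j)" "a (Suc j)"] by (simp add: mult_ac)
    also have "\<dots> \<le> a j * a (Suc (Suc j))"
      using sq[of "(blinfun_apply G ^^ j) x"] by (simp add: a_def power2_eq_square)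
    finally have "?q * a (Suc j) \<le> a (Suc (Suc j))"
      using Suc by (simp only: mult_le_cancel_left_pos)
    thus ?case using pos by blast
  qed
  have lower: "?q ^ j * nrm x \<le> a j" for j
  proof (induction j)
    case (Suc j)
    have "?q ^ Suc j * nrm x = ?q * (?q ^ j * nrm x)" by simp
    also have "\<dots> \<le> ?q * a j" using Suc q0 by (intro mult_left_mono) auto
    also have "\<dots> \<le> a (Suc j)" using step by blast
    finally show ?case .
  qed (simp add: a_def)
  have grow: "norm ((blinfun_apply G ^^ j) x) \<le> (norm G + 1) ^ j * norm x" for j
  proof (induction j)
    case (Suc j)
    have "norm ((blinfun_apply G ^^ Suc j) x) \<le> norm G * norm ((blinfun_apply G ^^ j) x)"
      by (simp add: norm_blinfun)
    also have "\<dots> \<le> (norm G + 1) * ((norm G + 1) ^ j * norm x)"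
      using Suc by (intro mult_mono) auto
    finally show ?case by (simp add: mult_ac)
  qed simp
  let ?C = "sqrt (norm A) * norm x"
  have "(?q / (norm G + 1)) ^ j \<le> ?C / nrm x" for j
  proof -
    have "?q ^ j * nrm x \<le> sqrt (norm A) * norm ((blinfun_apply G ^^ j) x)"
      using lower[of j] A_norm_le_norm[of "(blinfun_apply G ^^ j) x"] by (simp add: a_def)
    also have "\<dots> \<le> sqrt (norm A) * ((norm G + 1) ^ j * norm x)"
      by (intro mult_left_mono grow) simp
    finally have "?q ^ j * nrm x \<le> ?C * (norm G + 1) ^ j" by (simp only: mult_ac)
    thus ?thesis
      using n K unfolding power_divide[of ?q]
      by (simp only: pos_divide_le_eq pos_le_divide_eq zero_less_power times_divide_eq_left)
  qed
  moreover have "1 < ?q / (norm G + 1)"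
    using q K by (simp only: less_divide_eq_1_pos)
  then obtain j where "?C / nrm x < (?q / (norm G + 1)) ^ j"
    using real_arch_pow by blast
  ultimately show False using leD by blast
qed

text \<open>The squared seminorm of \<open>T x\<close> is the form at
  \<open>x, T\<^sup># T x\<close>, and \<open>T\<^sup># T\<close> is symmetric for the form, so
  \<open>A_symmetric_bounded\<close> applies. Boundedness in the seminorm is what makes the suprema
  below genuine upper bounds.\<close>

lemma A_adjointable_bounded:
  assumes T: "T \<in> A_adjointable A"
  obtains K where "0 \<le> K" "\<And>x. nrm (blinfun_apply T x) \<le> K * nrm x"
proof
  let ?G = "A_adjoint A T o\<^sub>L T"
  have adj: "A_inner A (blinfun_apply T x) y = A_inner A x (blinfun_apply (A_adjoint A T) y)" for x y
    by (rule A_inner_adjoint[OF T])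
  have adj': "A_inner A (blinfun_apply (A_adjoint A T) x) y = A_inner A x (blinfun_apply T y)" for x y
    by (metis adj conj_sym)
  have K: "norm ?G + 1 \<ge> 0" by simp
  show "0 \<le> sqrt (norm ?G + 1)" using K by simp
  fix x
  have "(nrm (blinfun_apply T x))\<^sup>2 = Re (A_inner A x (blinfun_apply ?G x))"
    by (simp add: nrm_sq adj)
  also have "\<dots> \<le> nrm x * nrm (blinfun_apply ?G x)"
    using Cauchy_Schwarz complex_Re_le_cmod order_trans by blast
  also have "\<dots> \<le> nrm x * ((norm ?G + 1) * nrm x)"
    by (intro mult_left_mono A_symmetric_bounded) (simp_all add: adj adj')
  also have "\<dots> = (sqrt (norm ?G + 1) * nrm x)\<^sup>2"
    using K by (simp add: power_mult_distrib) (simp add: power2_eq_square)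
  finally show "nrm (blinfun_apply T x) \<le> sqrt (norm ?G + 1) * nrm x"
    by (rule power2_le_imp_le) (use K in simp)
qed

end

section \<open>The completion and its operators\<close>

context positive_operator
begin

abbreviation V :: "(nat \<Rightarrow> 'h) set inner_space" where "V \<equiv> A_completion A"
abbreviation cl :: "(nat \<Rightarrow> 'h) \<Rightarrow> (nat \<Rightarrow> 'h) set" where "cl \<equiv> A_class A"

section \<open>Cauchy sequences for the seminorm\<close>

lemma A_CauchyI:
  assumes "\<And>e. e > 0 \<Longrightarrow> \<exists>N. \<forall>m\<ge>N. \<forall>n\<ge>N. nrm (u m - u n) < e"
  shows "u \<in> A_Cauchy A"
  using assms by (simp add: A_Cauchy_def A_norm_eq)

lemma A_CauchyD:
  assumes "u \<in> A_Cauchy A" "e > 0"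
  obtains N where "\<And>m n. N \<le> m \<Longrightarrow> N \<le> n \<Longrightarrow> nrm (u m - u n) < e"
proof -
  have "\<exists>N. \<forall>m\<ge>N. \<forall>n\<ge>N. nrm (u m - u n) < e"
    using assms by (simp add: A_Cauchy_def A_norm_eq)
  thus thesis using that by blast
qed

lemma A_Cauchy_const: "(\<lambda>n. x) \<in> A_Cauchy A"
  by (rule A_CauchyI) simp

lemma A_Cauchy_add:
  assumes u: "u \<in> A_Cauchy A" and v: "v \<in> A_Cauchy A"
  shows "(\<lambda>n. u n + v n) \<in> A_Cauchy A"
proof (rule A_CauchyI)
  fix e :: real assume "e > 0"
  hence e: "e / 2 > 0" by simp
  obtain N where N: "\<And>m n. N \<le> m \<Longrightarrow> N \<le> n \<Longrightarrow> nrm (u m - u n) < e / 2"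
    using A_CauchyD[OF u e] by blast
  obtain N' where N': "\<And>m n. N' \<le> m \<Longrightarrow> N' \<le> n \<Longrightarrow> nrm (v m - v n) < e / 2"
    using A_CauchyD[OF v e] by blast
  have "nrm (u m + v m - (u n + v n)) < e" if "max N N' \<le> m" "max N N' \<le> n" for m n
    using N[of m n] N'[of m n] that nrm_triangle[of "u m - u n" "v m - v n"]
    by (simp add: add_diff_add)
  thus "\<exists>N. \<forall>m\<ge>N. \<forall>n\<ge>N. nrm (u m + v m - (u n + v n)) < e" by blast
qed

lemma A_Cauchy_scale:
  assumes u: "u \<in> A_Cauchy A"
  shows "(\<lambda>n. c *\<^sub>C u n) \<in> A_Cauchy A"
proof (rule A_CauchyI)
  fix e :: real assume "e > 0"
  hence e: "e / (cmod c + 1) > 0" by (simp add: add_nonneg_pos)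
  obtain N where N: "\<And>m n. N \<le> m \<Longrightarrow> N \<le> n \<Longrightarrow> nrm (u m - u n) < e / (cmod c + 1)"
    using A_CauchyD[OF u e] by blast
  have "nrm (c *\<^sub>C u m - c *\<^sub>C u n) < e" if "N \<le> m" "N \<le> n" for m n
  proof -
    have "nrm (c *\<^sub>C u m - c *\<^sub>C u n) = cmod c * nrm (u m - u n)"
      by (simp flip: scaleC_diff_right nrm_scale)
    also have "\<dots> \<le> (cmod c + 1) * nrm (u m - u n)"
      by (intro mult_right_mono) auto
    also have "\<dots> < e"
      using N[OF that] by (simp add: pos_less_divide_eq add_nonneg_pos mult.commute)
    finally show ?thesis .
  qed
  thus "\<exists>N. \<forall>m\<ge>N. \<forall>n\<ge>N. nrm (c *\<^sub>C u m - c *\<^sub>C u n) < e" by blast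
qed

lemma nrm_convergent:
  assumes u: "u \<in> A_Cauchy A"
  shows "convergent (\<lambda>n. nrm (u n))"
proof (rule Cauchy_convergent, rule metric_CauchyI)
  fix e :: real assume "e > 0"
  then obtain N where N: "\<And>m n. N \<le> m \<Longrightarrow> N \<le> n \<Longrightarrow> nrm (u m - u n) < e"
    using A_CauchyD[OF u] by blast
  hence "\<forall>m\<ge>N. \<forall>n\<ge>N. dist (nrm (u m)) (nrm (u n)) < e"
    using nrm_reverse_triangle by (metis dist_real_def order_le_less_trans)
  thus "\<exists>M. \<forall>m\<ge>M. \<forall>n\<ge>M. dist (nrm (u m)) (nrm (u n)) < e" by blast
qed

lemma A_Cauchy_bounded:
  assumes "u \<in> A_Cauchy A"
  obtains K where "K > 0" "\<And>n. nrm (u n) \<le> K"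
proof -
  obtain K where "K > 0" "\<And>n. norm (nrm (u n)) \<le> K"
    using convergent_imp_Bseq[OF nrm_convergent[OF assms]] by (auto simp: Bseq_def)
  thus thesis using that by (metis abs_ge_self order_trans real_norm_def)
qed

section \<open>Equivalence classes and the operations on them\<close>

lemma A_equiv_iff:
  "(u, v) \<in> A_equiv A \<longleftrightarrow>
     u \<in> A_Cauchy A \<and> v \<in> A_Cauchy A \<and> (\<lambda>n. nrm (u n - v n)) \<longlonglongrightarrow> 0"
  by (simp add: A_equiv_def A_norm_eq)

lemma equiv_A_equiv: "equiv (A_Cauchy A) (A_equiv A)"
proof (rule equivI)
  show "A_equiv A \<subseteq> A_Cauchy A \<times> A_Cauchy A" by (auto simp: A_equiv_iff)
  show "refl_on (A_Cauchy A) (A_equiv A)" by (auto simp: refl_on_def A_equiv_iff)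
  show "sym (A_equiv A)" by (auto simp: sym_def A_equiv_iff nrm_minus_commute)
  show "trans (A_equiv A)"
  proof (rule transI)
    fix u v w assume uv: "(u, v) \<in> A_equiv A" and vw: "(v, w) \<in> A_equiv A"
    have "(\<lambda>n. nrm (u n - v n)) \<longlonglongrightarrow> 0" "(\<lambda>n. nrm (v n - w n)) \<longlonglongrightarrow> 0"
      using uv vw by (simp_all add: A_equiv_iff)
    hence "(\<lambda>n. nrm (u n - v n) + nrm (v n - w n)) \<longlonglongrightarrow> 0"
      by (rule tendsto_add_zero)
    hence "(\<lambda>n. nrm (u n - w n)) \<longlonglongrightarrow> 0"
      by (rule tendsto_sandwich[OF _ _ tendsto_const, rotated 2])
        (auto intro!: always_eventually nrm_triangle_diff)
    thus "(u, w) \<in> A_equiv A" using uv vw by (simp add: A_equiv_iff)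
  qed
qed

lemma cl_eq_iff:
  "u \<in> A_Cauchy A \<Longrightarrow> v \<in> A_Cauchy A \<Longrightarrow> cl u = cl v \<longleftrightarrow> (\<lambda>n. nrm (u n - v n)) \<longlonglongrightarrow> 0"
  unfolding A_class_def using eq_equiv_class_iff[OF equiv_A_equiv] by (simp add: A_equiv_iff)

lemma cl_in_carrier: "u \<in> A_Cauchy A \<Longrightarrow> cl u \<in> vcarrier V"
  by (simp add: A_completion_def A_class_def quotientI)

lemma carrierE:
  assumes "U \<in> vcarrier V"
  obtains u where "u \<in> A_Cauchy A" "U = cl u"
  using assms by (auto simp: A_completion_def A_class_def elim: quotientE)

text \<open>\<open>rep\<close> picks an arbitrary member of a class. Comparing it with a given
  \<open>u\<close> allows the operations defined through \<open>rep\<close> to be computed on any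
  representative.\<close>

lemma rep_cl:
  assumes u: "u \<in> A_Cauchy A"
  shows "rep (cl u) \<in> A_Cauchy A" "(\<lambda>n. nrm (rep (cl u) n - u n)) \<longlonglongrightarrow> 0" "cl (rep (cl u)) = cl u"
proof -
  have "u \<in> cl u"
    using u equiv_A_equiv unfolding A_class_def by (metis equiv_class_self)
  hence "rep (cl u) \<in> cl u" unfolding rep_def by (rule someI[where P = "\<lambda>v. v \<in> cl u"])
  hence "(u, rep (cl u)) \<in> A_equiv A" by (simp add: A_class_def)
  thus *: "rep (cl u) \<in> A_Cauchy A" "(\<lambda>n. nrm (rep (cl u) n - u n)) \<longlonglongrightarrow> 0"
    by (auto simp: A_equiv_iff nrm_minus_commute)
  thus "cl (rep (cl u)) = cl u" using u by (simp add: cl_eq_iff)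
qed

lemma vadd_cl:
  assumes u: "u \<in> A_Cauchy A" and v: "v \<in> A_Cauchy A"
  shows "vadd V (cl u) (cl v) = cl (\<lambda>n. u n + v n)"
proof -
  let ?u = "rep (cl u)" and ?v = "rep (cl v)"
  have "(\<lambda>n. nrm (?u n - u n) + nrm (?v n - v n)) \<longlonglongrightarrow> 0"
    using tendsto_add_zero[OF rep_cl(2)[OF u] rep_cl(2)[OF v]] .
  hence "(\<lambda>n. nrm (?u n + ?v n - (u n + v n))) \<longlonglongrightarrow> 0"
    by (rule tendsto_sandwich[OF _ _ tendsto_const, rotated 2])
      (auto intro!: always_eventually nrm_triangle simp: add_diff_add)
  thus ?thesis
    using u v by (simp add: A_completion_def cl_eq_iff A_Cauchy_add rep_cl(1))
qed

lemma vscale_cl: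
  assumes u: "u \<in> A_Cauchy A"
  shows "vscale V c (cl u) = cl (\<lambda>n. c *\<^sub>C u n)"
proof -
  have "(\<lambda>n. nrm (c *\<^sub>C rep (cl u) n - c *\<^sub>C u n)) \<longlonglongrightarrow> 0"
    unfolding scaleC_diff_right[symmetric] nrm_scale
    by (rule tendsto_mult_right_zero[OF rep_cl(2)[OF u]])
  thus ?thesis
    using u by (simp add: A_completion_def cl_eq_iff A_Cauchy_scale rep_cl(1))
qed

lemma inner_diff_le:
  "cmod (A_inner A x y - A_inner A x' y') \<le> nrm (x - x') * nrm y + nrm x' * nrm (y - y')"
proof -
  have "A_inner A x y - A_inner A x' y' = A_inner A (x - x') y + A_inner A x' (y - y')"
    by (simp add: diff_left diff_right)
  thus ?thesis
    using norm_triangle_ineq[of "A_inner A (x - x') y" "A_inner A x' (y - y')"]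
      Cauchy_Schwarz[of "x - x'" y] Cauchy_Schwarz[of x' "y - y'"] by simp
qed

lemma inner_convergent:
  assumes u: "u \<in> A_Cauchy A" and v: "v \<in> A_Cauchy A"
  shows "convergent (\<lambda>n. A_inner A (u n) (v n))"
proof (rule Cauchy_convergent, rule metric_CauchyI)
  fix e :: real assume e: "e > 0"
  obtain K where K: "K > 0" "\<And>n. nrm (u n) \<le> K" using A_Cauchy_bounded[OF u] by blast
  obtain L where L: "L > 0" "\<And>n. nrm (v n) \<le> L" using A_Cauchy_bounded[OF v] by blast
  have eL: "e / (2 * L) > 0" and eK: "e / (2 * K) > 0" using e K L by auto
  obtain N where N: "\<And>m n. N \<le> m \<Longrightarrow> N \<le> n \<Longrightarrow> nrm (u m - u n) < e / (2 * L)"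
    using A_CauchyD[OF u eL] by blast
  obtain N' where N': "\<And>m n. N' \<le> m \<Longrightarrow> N' \<le> n \<Longrightarrow> nrm (v m - v n) < e / (2 * K)"
    using A_CauchyD[OF v eK] by blast
  have "dist (A_inner A (u m) (v m)) (A_inner A (u n) (v n)) < e"
    if mn: "max N N' \<le> m" "max N N' \<le> n" for m n
  proof -
    have "nrm (u m - u n) * nrm (v m) \<le> nrm (u m - u n) * L"
      by (intro mult_left_mono L) simp
    also have "\<dots> < e / 2" using N[of m n] mn L by (simp add: field_simps)
    finally have 1: "nrm (u m - u n) * nrm (v m) < e / 2" .
    have "nrm (u n) * nrm (v m - v n) \<le> K * nrm (v m - v n)"
      by (intro mult_right_mono K) simp
    also have "\<dots> < e / 2" using N'[of m n] mn K by (simp add: field_simps)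
    finally have 2: "nrm (u n) * nrm (v m - v n) < e / 2" .
    show ?thesis
      unfolding dist_norm using inner_diff_le[of "u m" "v m" "u n" "v n"] 1 2 by linarith
  qed
  thus "\<exists>M. \<forall>m\<ge>M. \<forall>n\<ge>M. dist (A_inner A (u m) (v m)) (A_inner A (u n) (v n)) < e" by blast
qed

text \<open>By \<open>inner_diff_le\<close> and boundedness of Cauchy sequences, the inner products
  along \<open>u\<close>, \<open>v\<close> and along the chosen representatives differ by a null
  sequence.\<close>

lemma vinner_cl:
  assumes u: "u \<in> A_Cauchy A" and v: "v \<in> A_Cauchy A"
  shows "(\<lambda>n. A_inner A (u n) (v n)) \<longlonglongrightarrow> vinner V (cl u) (cl v)"
proof -
  let ?u = "rep (cl u)" and ?v = "rep (cl v)"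
  obtain L where L: "\<And>n. nrm (v n) \<le> L" using A_Cauchy_bounded[OF v] by blast
  obtain K where K: "\<And>n. nrm (?u n) \<le> K" using A_Cauchy_bounded[OF rep_cl(1)[OF u]] by blast
  have "(\<lambda>n. nrm (?u n - u n) * L + K * nrm (?v n - v n)) \<longlonglongrightarrow> 0"
    by (intro tendsto_add_zero tendsto_mult_left_zero tendsto_mult_right_zero rep_cl u v)
  hence "(\<lambda>n. A_inner A (u n) (v n) - A_inner A (?u n) (?v n)) \<longlonglongrightarrow> 0"
  proof (rule Lim_null_comparison[rotated])
    have "cmod (A_inner A (u n) (v n) - A_inner A (?u n) (?v n))
        \<le> nrm (?u n - u n) * L + K * nrm (?v n - v n)" for n
    proof -
      have "nrm (u n - ?u n) * nrm (v n) \<le> nrm (?u n - u n) * L"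
        unfolding nrm_minus_commute[of "u n"] by (intro mult_left_mono L) simp
      moreover have "nrm (?u n) * nrm (v n - ?v n) \<le> K * nrm (?v n - v n)"
        unfolding nrm_minus_commute[of "v n"] by (intro mult_right_mono K) simp
      ultimately show ?thesis
        using inner_diff_le[of "u n" "v n" "?u n" "?v n"] by linarith
    qed
    thus "\<forall>\<^sub>F n in sequentially. cmod (A_inner A (u n) (v n) - A_inner A (?u n) (?v n))
        \<le> nrm (?u n - u n) * L + K * nrm (?v n - v n)"
      by (rule always_eventually[OF allI])
  qed
  moreover have "(\<lambda>n. A_inner A (?u n) (?v n)) \<longlonglongrightarrow> vinner V (cl u) (cl v)"
    using inner_convergent[OF rep_cl(1)[OF u] rep_cl(1)[OF v]]
    by (simp add: A_completion_def convergent_LIMSEQ_iff)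
  ultimately have "(\<lambda>n. A_inner A (u n) (v n) - A_inner A (?u n) (?v n) + A_inner A (?u n) (?v n))
      \<longlonglongrightarrow> 0 + vinner V (cl u) (cl v)"
    by (rule tendsto_add)
  thus ?thesis by simp
qed

lemma vnorm_cl:
  assumes u: "u \<in> A_Cauchy A"
  shows "(\<lambda>n. nrm (u n)) \<longlonglongrightarrow> vnorm V (cl u)"
  unfolding seminorm_of_def vnorm_def by (intro tendsto_intros vinner_cl u)

text \<open>The canonical map of \<open>H\<close> into the completion preserves the seminorm, so
  operator norm bounds can be tested on vectors of \<open>H\<close>.\<close>

lemma vnorm_cl_const: "vnorm V (cl (\<lambda>n. x)) = nrm x"
  using LIMSEQ_unique[OF vnorm_cl[OF A_Cauchy_const] tendsto_const] .

lemma vnorm_cl_le: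
  assumes "u \<in> A_Cauchy A" "v \<in> A_Cauchy A"
    and "\<forall>\<^sub>F n in sequentially. nrm (u n) \<le> c * nrm (v n)"
  shows "vnorm V (cl u) \<le> c * vnorm V (cl v)"
  by (rule tendsto_le[OF _ _ vnorm_cl[OF assms(1)] assms(3)])
    (auto intro!: tendsto_intros vnorm_cl assms)

lemma vnorm_nonneg: "U \<in> vcarrier V \<Longrightarrow> 0 \<le> vnorm V U"
  by (elim carrierE) (auto intro!: tendsto_lowerbound[OF vnorm_cl] always_eventually)

lemma vnorm_vscale:
  assumes "U \<in> vcarrier V"
  shows "vnorm V (vscale V c U) = cmod c * vnorm V U"
proof -
  obtain u where u: "u \<in> A_Cauchy A" "U = cl u" using assms by (rule carrierE)
  have "(\<lambda>n. cmod c * nrm (u n)) \<longlonglongrightarrow> cmod c * vnorm V (cl u)"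
    by (intro tendsto_intros vnorm_cl u)
  hence "(\<lambda>n. nrm (c *\<^sub>C u n)) \<longlonglongrightarrow> cmod c * vnorm V (cl u)" by (simp add: nrm_scale)
  from LIMSEQ_unique[OF vnorm_cl[OF A_Cauchy_scale[OF u(1)]] this]
  show ?thesis by (simp add: u vscale_cl)
qed

section \<open>The operator norm on the completion\<close>

lemma op_norm_nonneg:
  assumes "\<And>U. U \<in> vcarrier V \<Longrightarrow> vnorm V (F U) \<le> K * vnorm V U"
  shows "0 \<le> op_norm V F"
  unfolding op_norm_def
proof (rule cSup_upper)
  show "bdd_above (insert 0 {vnorm V (F x) | x. x \<in> vcarrier V \<and> vnorm V x = 1})"
    by (rule bdd_aboveI[of _ "max 0 K"]) (use assms in fastforce)
qed simp

lemma op_norm_le: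
  assumes "0 \<le> c" "\<And>U. U \<in> vcarrier V \<Longrightarrow> vnorm V (F U) \<le> c * vnorm V U"
  shows "op_norm V F \<le> c"
  unfolding op_norm_def by (rule cSup_least) (use assms in fastforce)+

text \<open>Scale \<open>U\<close> to norm one. The bound \<open>K\<close> makes the set in
  \<open>op_norm\<close> bounded above and settles the vectors of norm zero.\<close>

lemma vnorm_le_op_norm:
  assumes bd: "\<And>U. U \<in> vcarrier V \<Longrightarrow> vnorm V (F U) \<le> K * vnorm V U"
    and hom: "\<And>c U. U \<in> vcarrier V \<Longrightarrow> vnorm V (F (vscale V c U)) = cmod c * vnorm V (F U)"
    and U: "U \<in> vcarrier V"
  shows "vnorm V (F U) \<le> op_norm V F * vnorm V U"
proof (cases "vnorm V U = 0")
  case True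
  thus ?thesis using bd[OF U] by simp
next
  case False
  hence n: "vnorm V U > 0" using vnorm_nonneg[OF U] by simp
  let ?c = "complex_of_real (1 / vnorm V U)"
  let ?U = "vscale V ?c U"
  have c: "cmod ?c = 1 / vnorm V U" using n by (simp only: norm_of_real) simp
  have "?U \<in> vcarrier V"
    using U by (auto elim!: carrierE simp: vscale_cl intro!: cl_in_carrier A_Cauchy_scale)
  moreover have "vnorm V ?U = 1" using n by (simp only: vnorm_vscale[OF U] c) simp
  ultimately have "vnorm V (F ?U) \<in> insert 0 {vnorm V (F x) | x. x \<in> vcarrier V \<and> vnorm V x = 1}"
    by blast
  moreover have "bdd_above (insert 0 {vnorm V (F x) | x. x \<in> vcarrier V \<and> vnorm V x = 1})"
    by (rule bdd_aboveI[of _ "max 0 K"]) (use bd in fastforce)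
  ultimately have "vnorm V (F ?U) \<le> op_norm V F"
    unfolding op_norm_def by (rule cSup_upper)
  hence "1 / vnorm V U * vnorm V (F U) \<le> op_norm V F" by (simp only: hom[OF U] c)
  thus ?thesis using n by (simp add: pos_divide_le_eq)
qed

text \<open>
  \<open>seq_op g\<close> is the limit of the operators induced by the maps \<open>g n\<close>: applying \<open>g n\<close> to the
  \<open>n\<close>-th member of a Cauchy sequence yields the limit directly as an element of the completion.
\<close>

definition seq_op :: "(nat \<Rightarrow> 'h \<Rightarrow> 'h) \<Rightarrow> (nat \<Rightarrow> 'h) set \<Rightarrow> (nat \<Rightarrow> 'h) set" where
  "seq_op g = (\<lambda>U\<in>vcarrier V. cl (\<lambda>n. g n (rep U n)))"

text \<open>Linear maps, uniformly bounded from some index on, that form a Cauchy sequence in the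
  operator seminorm. The uniformity in \<open>x\<close> makes the action on classes independent of
  representatives.\<close>

definition Cauchy_ops :: "(nat \<Rightarrow> 'h \<Rightarrow> 'h) \<Rightarrow> bool" where
  "Cauchy_ops g \<longleftrightarrow>
     (\<forall>n x y. g n (x + y) = g n x + g n y) \<and> (\<forall>n c x. g n (c *\<^sub>C x) = c *\<^sub>C g n x) \<and>
     (\<exists>K\<ge>0. \<forall>\<^sub>F n in sequentially. \<forall>x. nrm (g n x) \<le> K * nrm x) \<and>
     (\<forall>e>0. \<exists>N. \<forall>m\<ge>N. \<forall>n\<ge>N. \<forall>x. nrm (g m x - g n x) \<le> e * nrm x)"

lemma Cauchy_ops_add_vec: "Cauchy_ops g \<Longrightarrow> g n (x + y) = g n x + g n y"
  and Cauchy_ops_scale_vec: "Cauchy_ops g \<Longrightarrow> g n (c *\<^sub>C x) = c *\<^sub>C g n x"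
  by (simp_all add: Cauchy_ops_def)

lemma Cauchy_ops_diff_vec: "Cauchy_ops g \<Longrightarrow> g n (x - y) = g n x - g n y"
  using Cauchy_ops_add_vec[of g n "x - y" y] by simp

lemma Cauchy_ops_bound:
  assumes "Cauchy_ops g"
  obtains K where "K \<ge> 0" "\<forall>\<^sub>F n in sequentially. \<forall>x. nrm (g n x) \<le> K * nrm x"
  using assms by (auto simp: Cauchy_ops_def)

lemma Cauchy_ops_const:
  assumes "\<And>x y. h (x + y) = h x + h y" "\<And>c x. h (c *\<^sub>C x) = c *\<^sub>C h x"
    "K \<ge> 0" "\<And>x. nrm (h x) \<le> K * nrm x"
  shows "Cauchy_ops (\<lambda>n. h)"
  unfolding Cauchy_ops_def using assms by auto

lemma Cauchy_ops_add:
  assumes g: "Cauchy_ops g" and h: "Cauchy_ops h"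
  shows "Cauchy_ops (\<lambda>n x. g n x + h n x)"
  unfolding Cauchy_ops_def
proof (intro conjI allI impI)
  show "g n (x + y) + h n (x + y) = g n x + h n x + (g n y + h n y)" for n x y
    by (simp add: Cauchy_ops_add_vec[OF g] Cauchy_ops_add_vec[OF h])
  show "g n (c *\<^sub>C x) + h n (c *\<^sub>C x) = c *\<^sub>C (g n x + h n x)" for n c x
    by (simp add: Cauchy_ops_scale_vec[OF g] Cauchy_ops_scale_vec[OF h] scaleC_add_right)
  obtain K where K: "K \<ge> 0" "\<forall>\<^sub>F n in sequentially. \<forall>x. nrm (g n x) \<le> K * nrm x"
    using g by (rule Cauchy_ops_bound)
  obtain L where L: "L \<ge> 0" "\<forall>\<^sub>F n in sequentially. \<forall>x. nrm (h n x) \<le> L * nrm x"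
    using h by (rule Cauchy_ops_bound)
  have "\<forall>\<^sub>F n in sequentially. \<forall>x. nrm (g n x + h n x) \<le> (K + L) * nrm x"
    using K(2) L(2)
  proof eventually_elim
    case (elim n)
    show ?case
    proof
      fix x
      show "nrm (g n x + h n x) \<le> (K + L) * nrm x"
        using elim nrm_triangle[of "g n x" "h n x"] unfolding distrib_right by (meson add_mono order_trans)
    qed
  qed
  thus "\<exists>K\<ge>0. \<forall>\<^sub>F n in sequentially. \<forall>x. nrm (g n x + h n x) \<le> K * nrm x"
    using K(1) L(1) by (intro exI[of _ "K + L"]) simp
  fix e :: real assume "e > 0"
  hence e: "e / 2 > 0" by simp
  obtain N where N: "\<And>m n x. N \<le> m \<Longrightarrow> N \<le> n \<Longrightarrow> nrm (g m x - g n x) \<le> e / 2 * nrm x"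
    using g e unfolding Cauchy_ops_def by meson
  obtain N' where N': "\<And>m n x. N' \<le> m \<Longrightarrow> N' \<le> n \<Longrightarrow> nrm (h m x - h n x) \<le> e / 2 * nrm x"
    using h e unfolding Cauchy_ops_def by meson
  have "nrm (g m x + h m x - (g n x + h n x)) \<le> e * nrm x"
    if "max N N' \<le> m" "max N N' \<le> n" for m n x
    using N[of m n x] N'[of m n x] that nrm_triangle[of "g m x - g n x" "h m x - h n x"]
    by (simp add: add_diff_add)
  thus "\<exists>N. \<forall>m\<ge>N. \<forall>n\<ge>N. \<forall>x. nrm (g m x + h m x - (g n x + h n x)) \<le> e * nrm x" by blast
qed

lemma Cauchy_ops_uminus:
  assumes g: "Cauchy_ops g"
  shows "Cauchy_ops (\<lambda>n x. (- 1) *\<^sub>C g n x)"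
proof -
  have "nrm (- g m x - - g n x) = nrm (g m x - g n x)" for m n x
    using nrm_minus_commute[of "g n x" "g m x"] by simp
  thus ?thesis
    using g by (simp add: Cauchy_ops_def scaleC_minus_one nrm_uminus scaleC_minus_right)
qed

text \<open>Compare \<open>g m (u m)\<close> with \<open>g n (u n)\<close> through
  \<open>g m (u n)\<close>: one difference is small because \<open>g m\<close> is bounded, the other
  because the maps are close and \<open>u\<close> is bounded.\<close>

lemma Cauchy_ops_apply:
  assumes g: "Cauchy_ops g" and u: "u \<in> A_Cauchy A"
  shows "(\<lambda>n. g n (u n)) \<in> A_Cauchy A"
proof (rule A_CauchyI)
  fix e :: real assume e: "e > 0"
  obtain L where L: "L > 0" "\<And>n. nrm (u n) \<le> L" using A_Cauchy_bounded[OF u] by blast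
  obtain K where K: "K \<ge> 0" "\<forall>\<^sub>F n in sequentially. \<forall>x. nrm (g n x) \<le> K * nrm x"
    using g by (rule Cauchy_ops_bound)
  then obtain N1 where N1: "\<And>n x. N1 \<le> n \<Longrightarrow> nrm (g n x) \<le> K * nrm x"
    by (auto simp: eventually_sequentially)
  \<comment> \<open>\<open>K + 1\<close> in place of \<open>K\<close> avoids division by
    zero.\<close>
  have "e / (2 * (K + 1)) > 0" using e K(1) by simp
  then obtain N2 where N2: "\<And>m n. N2 \<le> m \<Longrightarrow> N2 \<le> n \<Longrightarrow> nrm (u m - u n) < e / (2 * (K + 1))"
    using A_CauchyD[OF u] by blast
  have "e / (2 * L) > 0" using e L(1) by simp
  then obtain N3 where N3: "\<And>m n x. N3 \<le> m \<Longrightarrow> N3 \<le> n \<Longrightarrow> nrm (g m x - g n x) \<le> e / (2 * L) * nrm x"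
    using g unfolding Cauchy_ops_def by meson
  have "nrm (g m (u m) - g n (u n)) < e"
    if mn: "max N1 (max N2 N3) \<le> m" "max N1 (max N2 N3) \<le> n" for m n
  proof -
    have "nrm (g m (u m) - g m (u n)) \<le> K * nrm (u m - u n)"
      using N1[of m "u m - u n"] mn by (simp add: Cauchy_ops_diff_vec[OF g])
    also have "\<dots> \<le> (K + 1) * nrm (u m - u n)" by (intro mult_right_mono) auto
    also have "\<dots> < e / 2" using N2[of m n] mn K(1) by (simp add: field_simps)
    finally have 1: "nrm (g m (u m) - g m (u n)) < e / 2" .
    have "nrm (g m (u n) - g n (u n)) \<le> e / (2 * L) * nrm (u n)" using N3 mn by simp
    also have "\<dots> \<le> e / (2 * L) * L" using L e by (intro mult_left_mono) auto
    also have "\<dots> = e / 2" using L by simp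
    finally show ?thesis
      using 1 nrm_triangle_diff[of "g m (u m)" "g n (u n)" "g m (u n)"] by linarith
  qed
  thus "\<exists>N. \<forall>m\<ge>N. \<forall>n\<ge>N. nrm (g m (u m) - g n (u n)) < e" by blast
qed

text \<open>For large \<open>n\<close> the maps enlarge the difference of two representatives by at
  most a fixed factor, so a null difference stays null.\<close>

lemma seq_op_cl:
  assumes g: "Cauchy_ops g" and u: "u \<in> A_Cauchy A"
  shows "seq_op g (cl u) = cl (\<lambda>n. g n (u n))"
proof -
  obtain K where K: "K \<ge> 0" "\<forall>\<^sub>F n in sequentially. \<forall>x. nrm (g n x) \<le> K * nrm x"
    using g by (rule Cauchy_ops_bound)
  have "(\<lambda>n. K * nrm (rep (cl u) n - u n)) \<longlonglongrightarrow> 0"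
    by (rule tendsto_mult_right_zero[OF rep_cl(2)[OF u]])
  hence "(\<lambda>n. nrm (g n (rep (cl u) n) - g n (u n))) \<longlonglongrightarrow> 0"
  proof (rule tendsto_sandwich[OF _ _ tendsto_const, rotated 2])
    show "\<forall>\<^sub>F n in sequentially. nrm (g n (rep (cl u) n) - g n (u n)) \<le> K * nrm (rep (cl u) n - u n)"
      using K(2) by eventually_elim (simp flip: Cauchy_ops_diff_vec[OF g])
  qed (auto intro!: always_eventually)
  thus ?thesis
    using u g by (simp add: seq_op_def cl_in_carrier cl_eq_iff Cauchy_ops_apply rep_cl(1))
qed

lemma seq_op_eqI:
  assumes "\<And>u. u \<in> A_Cauchy A \<Longrightarrow> F (cl u) = seq_op g (cl u)" "F \<in> extensional (vcarrier V)"
  shows "F = seq_op g"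
proof (rule extensionalityI[OF assms(2)])
  show "seq_op g \<in> extensional (vcarrier V)" by (simp add: seq_op_def)
  show "F U = seq_op g U" if "U \<in> vcarrier V" for U
    using that assms(1) by (auto elim: carrierE)
qed

lemma op_add_seq_op:
  assumes "Cauchy_ops g" "Cauchy_ops h"
  shows "op_add V (seq_op g) (seq_op h) = seq_op (\<lambda>n x. g n x + h n x)"
  by (rule seq_op_eqI)
    (simp_all add: assms op_add_def seq_op_cl Cauchy_ops_add vadd_cl Cauchy_ops_apply cl_in_carrier)

lemma op_uminus_seq_op:
  assumes "Cauchy_ops g"
  shows "op_scale V (- 1) (seq_op g) = seq_op (\<lambda>n x. (- 1) *\<^sub>C g n x)"
  by (rule seq_op_eqI)
    (simp_all add: assms op_scale_def seq_op_cl Cauchy_ops_uminus vscale_cl Cauchy_ops_apply cl_in_carrier)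

lemma vnorm_seq_op_le:
  assumes g: "Cauchy_ops g" and le: "\<forall>\<^sub>F n in sequentially. \<forall>x. nrm (g n x) \<le> c * nrm x"
    and "U \<in> vcarrier V"
  shows "vnorm V (seq_op g U) \<le> c * vnorm V U"
proof -
  obtain u where u: "u \<in> A_Cauchy A" "U = cl u" using assms(3) by (rule carrierE)
  have "\<forall>\<^sub>F n in sequentially. nrm (g n (u n)) \<le> c * nrm (u n)"
    using le by eventually_elim blast
  thus ?thesis using g u by (simp add: seq_op_cl vnorm_cl_le Cauchy_ops_apply)
qed

lemma seq_op_in_ops:
  assumes g: "Cauchy_ops g"
  shows "seq_op g \<in> ops V"
proof -
  obtain K where K: "\<forall>\<^sub>F n in sequentially. \<forall>x. nrm (g n x) \<le> K * nrm x"
    using g by (rule Cauchy_ops_bound)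
  have "seq_op g \<in> vcarrier V \<rightarrow>\<^sub>E vcarrier V"
  proof (rule PiE_I)
    show "seq_op g U \<in> vcarrier V" if U: "U \<in> vcarrier V" for U
      using U by (rule carrierE) (simp add: seq_op_cl[OF g] cl_in_carrier Cauchy_ops_apply[OF g])
  qed (simp add: seq_op_def)
  moreover have "seq_op g (vadd V U W) = vadd V (seq_op g U) (seq_op g W)"
    if UW: "U \<in> vcarrier V" "W \<in> vcarrier V" for U W
  proof -
    obtain u where u: "u \<in> A_Cauchy A" "U = cl u" using UW(1) by (rule carrierE)
    obtain w where w: "w \<in> A_Cauchy A" "W = cl w" using UW(2) by (rule carrierE)
    show ?thesis
      using u w by (simp add: seq_op_cl[OF g] vadd_cl A_Cauchy_add Cauchy_ops_apply[OF g] Cauchy_ops_add_vec[OF g])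
  qed
  moreover have "seq_op g (vscale V c U) = vscale V c (seq_op g U)" if U: "U \<in> vcarrier V" for c U
    using U by (rule carrierE)
      (simp add: seq_op_cl[OF g] vscale_cl A_Cauchy_scale Cauchy_ops_apply[OF g] Cauchy_ops_scale_vec[OF g])
  moreover have "\<forall>U\<in>vcarrier V. vnorm V (seq_op g U) \<le> K * vnorm V U"
    by (intro ballI vnorm_seq_op_le g K)
  ultimately show ?thesis unfolding ops_def by auto
qed

lemma vnorm_le_op_norm_ops:
  assumes F: "F \<in> ops V" and U: "U \<in> vcarrier V"
  shows "vnorm V (F U) \<le> op_norm V F * vnorm V U"
proof -
  obtain K where K: "\<forall>U\<in>vcarrier V. vnorm V (F U) \<le> K * vnorm V U"
    using F by (auto simp: ops_def)
  show ?thesis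
  proof (rule vnorm_le_op_norm[OF bspec[OF K] _ U])
    show "vnorm V (F (vscale V c W)) = cmod c * vnorm V (F W)" if "W \<in> vcarrier V" for c W
      using F that by (auto simp: ops_def intro!: vnorm_vscale)
  qed
qed

lemma op_norm_ops_nonneg: "F \<in> ops V \<Longrightarrow> 0 \<le> op_norm V F"
  by (auto simp: ops_def intro: op_norm_nonneg)

section \<open>Vector space laws and closure properties of the bounded operators\<close>

lemma vadd_in_carrier: "U \<in> vcarrier V \<Longrightarrow> W \<in> vcarrier V \<Longrightarrow> vadd V U W \<in> vcarrier V"
  by (elim carrierE) (simp add: vadd_cl cl_in_carrier A_Cauchy_add)

lemma vscale_in_carrier: "U \<in> vcarrier V \<Longrightarrow> vscale V c U \<in> vcarrier V"
  by (elim carrierE) (simp add: vscale_cl cl_in_carrier A_Cauchy_scale)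

lemma vnorm_vadd_le:
  assumes "U \<in> vcarrier V" "W \<in> vcarrier V"
  shows "vnorm V (vadd V U W) \<le> vnorm V U + vnorm V W"
proof -
  obtain u where u: "u \<in> A_Cauchy A" "U = cl u" using assms(1) by (rule carrierE)
  obtain w where w: "w \<in> A_Cauchy A" "W = cl w" using assms(2) by (rule carrierE)
  have "vnorm V (cl (\<lambda>n. u n + w n)) \<le> vnorm V (cl u) + vnorm V (cl w)"
    by (rule tendsto_le[OF _ tendsto_add[OF vnorm_cl[OF u(1)] vnorm_cl[OF w(1)]]
          vnorm_cl[OF A_Cauchy_add[OF u(1) w(1)]]])
      (auto intro!: always_eventually nrm_triangle)
  thus ?thesis by (simp add: u w vadd_cl)
qed

text \<open>The regrouping behind additivity of a sum of two operators.\<close>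

lemma vadd_medial:
  assumes "U1 \<in> vcarrier V" "U2 \<in> vcarrier V" "W1 \<in> vcarrier V" "W2 \<in> vcarrier V"
  shows "vadd V (vadd V U1 U2) (vadd V W1 W2) = vadd V (vadd V U1 W1) (vadd V U2 W2)"
  using assms by (elim carrierE) (simp add: vadd_cl A_Cauchy_add add_ac)

lemma vscale_vadd:
  assumes "U \<in> vcarrier V" "W \<in> vcarrier V"
  shows "vscale V c (vadd V U W) = vadd V (vscale V c U) (vscale V c W)"
  using assms by (elim carrierE) (simp add: vadd_cl vscale_cl A_Cauchy_add A_Cauchy_scale scaleC_add_right)

lemma vscale_vscale_commute:
  assumes "U \<in> vcarrier V"
  shows "vscale V c (vscale V d U) = vscale V d (vscale V c U)"
  using assms by (elim carrierE) (simp add: vscale_cl A_Cauchy_scale scaleC_scaleC mult.commute)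

lemma ops_closed: "F \<in> ops V \<Longrightarrow> U \<in> vcarrier V \<Longrightarrow> F U \<in> vcarrier V"
  by (auto simp: ops_def)

lemma ops_bound:
  assumes "F \<in> ops V"
  obtains K where "\<And>U. U \<in> vcarrier V \<Longrightarrow> vnorm V (F U) \<le> K * vnorm V U"
proof -
  have "\<exists>K. \<forall>U\<in>vcarrier V. vnorm V (F U) \<le> K * vnorm V U"
    using assms by (simp add: ops_def)
  thus thesis using that by blast
qed

lemma opsI:
  assumes bound: "\<And>U. U \<in> vcarrier V \<Longrightarrow> vnorm V (F U) \<le> K * vnorm V U"
    and "F \<in> vcarrier V \<rightarrow>\<^sub>E vcarrier V"
    and "\<And>U W. U \<in> vcarrier V \<Longrightarrow> W \<in> vcarrier V \<Longrightarrow> F (vadd V U W) = vadd V (F U) (F W)"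
    and "\<And>c U. U \<in> vcarrier V \<Longrightarrow> F (vscale V c U) = vscale V c (F U)"
  shows "F \<in> ops V"
proof -
  have "\<exists>K. \<forall>U\<in>vcarrier V. vnorm V (F U) \<le> K * vnorm V U" using bound by auto
  thus ?thesis unfolding ops_def using assms(2-4) by simp
qed

lemma op_add_in_ops:
  assumes F: "F \<in> ops V" and G: "G \<in> ops V"
  shows "op_add V F G \<in> ops V"
proof -
  obtain K where K: "\<And>U. U \<in> vcarrier V \<Longrightarrow> vnorm V (F U) \<le> K * vnorm V U"
    using ops_bound[OF F] by blast
  obtain L where L: "\<And>U. U \<in> vcarrier V \<Longrightarrow> vnorm V (G U) \<le> L * vnorm V U"
    using ops_bound[OF G] by blast
  have "vnorm V (op_add V F G U) \<le> (K + L) * vnorm V U" if U: "U \<in> vcarrier V" for U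
    using vnorm_vadd_le[OF ops_closed[OF F U] ops_closed[OF G U]] K[OF U] L[OF U] U
    by (simp add: op_add_def distrib_right)
  moreover have "op_add V F G \<in> vcarrier V \<rightarrow>\<^sub>E vcarrier V"
    by (rule PiE_I) (simp_all add: op_add_def vadd_in_carrier ops_closed[OF F] ops_closed[OF G])
  moreover have "op_add V F G (vadd V U W) = vadd V (op_add V F G U) (op_add V F G W)"
    if "U \<in> vcarrier V" "W \<in> vcarrier V" for U W
    using that F G by (simp add: op_add_def vadd_in_carrier vadd_medial ops_closed)
      (simp add: ops_def vadd_medial[symmetric] ops_closed[OF F] ops_closed[OF G])
  moreover have "op_add V F G (vscale V c U) = vscale V c (op_add V F G U)"
    if "U \<in> vcarrier V" for c U
    using that F G by (simp add: op_add_def vscale_in_carrier vscale_vadd ops_closed) (simp add: ops_def)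
  ultimately show ?thesis by (rule opsI)
qed

lemma op_scale_in_ops:
  assumes F: "F \<in> ops V"
  shows "op_scale V c F \<in> ops V"
proof -
  obtain K where K: "\<And>U. U \<in> vcarrier V \<Longrightarrow> vnorm V (F U) \<le> K * vnorm V U"
    using ops_bound[OF F] by blast
  have "vnorm V (op_scale V c F U) \<le> (cmod c * K) * vnorm V U" if U: "U \<in> vcarrier V" for U
    using mult_left_mono[OF K[OF U], of "cmod c"] U
    by (simp add: op_scale_def vnorm_vscale[OF ops_closed[OF F U]] mult.assoc)
  moreover have "op_scale V c F \<in> vcarrier V \<rightarrow>\<^sub>E vcarrier V"
    by (rule PiE_I) (simp_all add: op_scale_def vscale_in_carrier ops_closed[OF F])
  moreover have "op_scale V c F (vadd V U W) = vadd V (op_scale V c F U) (op_scale V c F W)"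
    if "U \<in> vcarrier V" "W \<in> vcarrier V" for U W
    using that F by (simp add: op_scale_def vadd_in_carrier vscale_vadd[symmetric] ops_closed) (simp add: ops_def)
  moreover have "op_scale V c F (vscale V d U) = vscale V d (op_scale V c F U)"
    if "U \<in> vcarrier V" for d U
  proof -
    have "F (vscale V d U) = vscale V d (F U)" using that F by (simp add: ops_def)
    thus ?thesis
      using that F by (simp add: op_scale_def vscale_in_carrier vscale_vscale_commute[of "F U"] ops_closed)
  qed
  ultimately show ?thesis by (rule opsI)
qed

end

section \<open>Powers of A-positive operators\<close>

text \<open>Young's inequality for \<open>t\<close> and \<open>s powr (r - 1)\<close> with exponents
  \<open>r\<close> and \<open>r / (r - 1)\<close>. The cases \<open>s = 0\<close> and
  \<open>r = 1\<close> are direct.\<close>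

lemma powr_tangent_le:
  fixes s t r :: real
  assumes s: "0 \<le> s" and t: "0 \<le> t" and r: "1 \<le> r"
  shows "s powr r + r * s powr (r - 1) * (t - s) \<le> t powr r"
proof (cases "s = 0 \<or> r = 1")
  case True
  thus ?thesis using assms by auto
next
  case False
  hence s0: "s > 0" and r1: "r > 1" using s r by auto
  define q where "q = r / (r - 1)"
  have q: "q > 1" "1 / r + 1 / q = 1" "(r - 1) * q = r"
    using r1 by (simp_all add: q_def field_simps)
  have "t * s powr (r - 1) \<le> t powr r / r + (s powr (r - 1)) powr q / q"
    using r1 q t by (intro Youngs_inequality) auto
  also have "(s powr (r - 1)) powr q = s powr r" by (simp add: powr_powr q)
  finally have "r * (t * s powr (r - 1)) \<le> r * (t powr r / r + s powr r / q)"
    using r1 by (intro mult_left_mono) auto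
  also have "\<dots> = t powr r + (r / q) * s powr r" using r1 by (simp add: distrib_left)
  also have "r / q = r - 1" using r1 by (simp add: q_def)
  finally have "r * (t * s powr (r - 1)) \<le> t powr r + (r - 1) * s powr r" .
  moreover have "s powr (r - 1) * s = s powr r"
    using s0 powr_add[of s "r - 1" 1] by simp
  ultimately show ?thesis by (simp add: algebra_simps)
qed

text \<open>Average the tangent inequalities at the midpoint, evaluated at \<open>s\<close> and at
  \<open>t\<close>; the linear terms cancel.\<close>

lemma powr_midpoint_le:
  fixes s t r :: real
  assumes "0 \<le> s" "0 \<le> t" "1 \<le> r"
  shows "((s + t) / 2) powr r \<le> (s powr r + t powr r) / 2"
proof -
  define m where "m = (s + t) / 2"
  define c where "c = r * m powr (r - 1) * ((s - t) / 2)"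
  have m: "0 \<le> m" using assms by (simp add: m_def)
  have d: "s - m = (s - t) / 2" "t - m = - ((s - t) / 2)" by (simp_all add: m_def field_simps)
  have "m powr r + c \<le> s powr r"
    using powr_tangent_le[of m s r] m assms unfolding d(1) c_def by simp
  moreover have "m powr r - c \<le> t powr r"
    using powr_tangent_le[of m t r] m assms unfolding d(2) c_def by simp
  ultimately have "m powr r \<le> (s powr r + t powr r) / 2" by argo
  thus ?thesis by (simp only: m_def)
qed

text \<open>Stone-Weierstrass with error \<open>1 / (n + 1)\<close>. Such a sequence keeps the
  condition in \<open>op_powr\<close> from being vacuous and thus underlies the uniqueness of the
  power.\<close>

lemma powr_poly_approximation:
  fixes M r :: real
  assumes r: "r > 0"
  obtains p :: "nat \<Rightarrow> real poly"
  where "uniform_limit {0..M} (\<lambda>n. poly (p n)) (\<lambda>t. t powr r) sequentially"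
proof -
  have cont: "continuous_on {0..M} (\<lambda>t. t powr r)"
    using r by (intro continuous_on_powr' continuous_intros) auto
  have "\<exists>p::real poly. \<forall>t\<in>{0..M}. \<bar>t powr r - poly p t\<bar> < inverse (real (Suc n))" for n
  proof -
    obtain g where g: "real_polynomial_function g"
      "\<And>t. t \<in> {0..M} \<Longrightarrow> \<bar>t powr r - g t\<bar> < inverse (real (Suc n))"
      using Stone_Weierstrass_real_polynomial_function[OF compact_Icc cont, of "inverse (real (Suc n))"]
      by auto
    from g(1) obtain a m where "g = (\<lambda>t. \<Sum>i\<le>m. a i * t ^ i)"
      unfolding real_polynomial_function_iff_sum by blast
    hence "g = poly (\<Sum>i\<le>m. monom (a i) i)" by (simp add: fun_eq_iff poly_sum poly_monom)
    thus ?thesis using g(2) by blast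
  qed
  then obtain p :: "nat \<Rightarrow> real poly" where
    p: "\<And>n t. t \<in> {0..M} \<Longrightarrow> \<bar>t powr r - poly (p n) t\<bar> < inverse (real (Suc n))"
    by metis
  have "uniform_limit {0..M} (\<lambda>n. poly (p n)) (\<lambda>t. t powr r) sequentially"
    unfolding uniform_limit_sequentially_iff
  proof (intro allI impI)
    fix e :: real assume "e > 0"
    then obtain N where N: "inverse (real (Suc N)) < e" using reals_Archimedean by blast
    have "dist (poly (p n) t) (t powr r) < e" if n: "n \<ge> N" and t: "t \<in> {0..M}" for n t
    proof -
      have "inverse (real (Suc n)) \<le> inverse (real (Suc N))"
        using n by (intro le_imp_inverse_le) auto
      thus ?thesis
        using p[OF t, of n] N unfolding dist_real_def abs_minus_commute[of "poly (p n) t"] by linarith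
    qed
    thus "\<exists>N. \<forall>n\<ge>N. \<forall>t\<in>{0..M}. dist (poly (p n) t) (t powr r) < e" by blast
  qed
  thus thesis by (rule that)
qed

section \<open>Functional calculus of an A-positive operator\<close>

locale A_positive_operator = positive_operator A for A :: "'h::chilbert_space \<Rightarrow>\<^sub>L 'h" +
  fixes T :: "'h \<Rightarrow>\<^sub>L 'h"
  assumes T_ops: "T \<in> bounded_ops"
    and T_sym: "A_inner A (blinfun_apply T x) y = A_inner A x (blinfun_apply T y)"
    and T_pos: "0 \<le> Re (A_inner A (blinfun_apply T x) x)"
begin

lemma induced_op_eq: "induced_op A T = seq_op (\<lambda>n. blinfun_apply T)"
  by (simp add: induced_op_def seq_op_def)

lemma Cauchy_ops_T: "Cauchy_ops (\<lambda>n. blinfun_apply T)"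
  using A_symmetric_bounded[OF T_sym]
  by (intro Cauchy_ops_const[where K = "norm T + 1"])
    (simp_all add: blinfun.add_right bounded_ops_scaleC[OF T_ops])

abbreviation T_norm :: real where "T_norm \<equiv> op_norm V (induced_op A T)"

lemma T_norm_nonneg: "0 \<le> T_norm"
  unfolding induced_op_eq by (intro op_norm_ops_nonneg seq_op_in_ops Cauchy_ops_T)

lemma T_norm_bound: "nrm (blinfun_apply T x) \<le> T_norm * nrm x"
proof -
  have "vnorm V (induced_op A T (cl (\<lambda>n. x))) \<le> T_norm * vnorm V (cl (\<lambda>n. x))"
    unfolding induced_op_eq
    by (intro vnorm_le_op_norm_ops seq_op_in_ops Cauchy_ops_T cl_in_carrier A_Cauchy_const)
  thus ?thesis
    unfolding induced_op_eq seq_op_cl[OF Cauchy_ops_T A_Cauchy_const] vnorm_cl_const .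
qed

text \<open>Taking the norm of the induced operator as the form bound makes the polynomial estimates
  refer to the same interval as \<open>op_powr\<close>.\<close>

sublocale pos_op "A_inner A" "blinfun_apply T" T_norm
proof
  fix x y :: 'h and c :: complex
  show "blinfun_apply T (x + y) = blinfun_apply T x + blinfun_apply T y"
    by (rule blinfun.add_right)
  show "blinfun_apply T (c *\<^sub>C x) = c *\<^sub>C blinfun_apply T x"
    by (rule bounded_ops_scaleC[OF T_ops])
  have "Re (A_inner A (blinfun_apply T x) x) \<le> nrm (blinfun_apply T x) * nrm x"
    using Cauchy_Schwarz complex_Re_le_cmod order_trans by blast
  also have "\<dots> \<le> T_norm * nrm x * nrm x"
    by (intro mult_right_mono T_norm_bound nrm_nonneg)
  finally show "Re (A_inner A (blinfun_apply T x) x) \<le> T_norm * (nrm x)\<^sup>2"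
    by (simp add: power2_eq_square mult.assoc)
qed (rule T_sym T_pos T_norm_nonneg)+

lemma Cauchy_ops_ev: "Cauchy_ops (\<lambda>n. ev p)"
proof -
  obtain K where "K \<ge> 0" "\<forall>x. nrm (ev p x) \<le> K * nrm x" using ev_bounded by blast
  thus ?thesis by (intro Cauchy_ops_const) (auto simp: ev_vec_add ev_vec_scale)
qed

text \<open>A polynomial in the induced operator acts memberwise on Cauchy sequences, so the
  estimates proved on \<open>H\<close> carry over to the completion.\<close>

lemma op_poly_eq: "op_poly V p (induced_op A T) = seq_op (\<lambda>n. ev (of_real_poly p))"
proof (induction p)
  case 0
  have zero: "op_poly V 0 (induced_op A T) = op_scale V 0 (op_id V)" by (simp add: op_poly_def)
  show ?case
  proof (rule seq_op_eqI)
    fix u assume u: "u \<in> A_Cauchy A"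
    have "op_poly V 0 (induced_op A T) (cl u) = vscale V 0 (cl u)"
      by (simp add: zero op_scale_def op_id_def cl_in_carrier[OF u])
    also have "\<dots> = seq_op (\<lambda>n. ev (of_real_poly 0)) (cl u)"
      by (simp add: vscale_cl[OF u] seq_op_cl[OF Cauchy_ops_ev u])
    finally show "op_poly V 0 (induced_op A T) (cl u) = seq_op (\<lambda>n. ev (of_real_poly 0)) (cl u)" .
  qed (unfold zero op_scale_def, rule restrict_extensional)
next
  case (pCons a p)
  have step: "op_poly V (pCons a p) (induced_op A T) =
      op_add V (op_scale V (complex_of_real a) (op_id V))
        (compose (vcarrier V) (induced_op A T) (op_poly V p (induced_op A T)))"
    \<comment> \<open>The induction excludes the zero polynomial, for which \<open>coeffs\<close>
      would drop the leading entry and Horner's scheme would have no step.\<close>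
    using pCons.hyps by (auto simp: op_poly_def cCons_def)
  show ?case
  proof (rule seq_op_eqI)
    fix u assume u: "u \<in> A_Cauchy A"
    have evu: "(\<lambda>n. ev (of_real_poly p) (u n)) \<in> A_Cauchy A"
      by (rule Cauchy_ops_apply[OF Cauchy_ops_ev u])
    have "op_poly V (pCons a p) (induced_op A T) (cl u) =
        vadd V (vscale V (complex_of_real a) (cl u))
          (seq_op (\<lambda>n. blinfun_apply T) (seq_op (\<lambda>n. ev (of_real_poly p)) (cl u)))"
      unfolding step pCons.IH
      by (simp add: induced_op_eq op_add_def op_scale_def op_id_def compose_def cl_in_carrier[OF u])
    also have "\<dots> = cl (\<lambda>n. complex_of_real a *\<^sub>C u n + blinfun_apply T (ev (of_real_poly p) (u n)))"
      unfolding seq_op_cl[OF Cauchy_ops_ev u] seq_op_cl[OF Cauchy_ops_T evu] vscale_cl[OF u]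
      by (rule vadd_cl[OF A_Cauchy_scale[OF u] Cauchy_ops_apply[OF Cauchy_ops_T evu]])
    also have "\<dots> = seq_op (\<lambda>n. ev (of_real_poly (pCons a p))) (cl u)"
      unfolding seq_op_cl[OF Cauchy_ops_ev u] by (simp add: map_poly_pCons)
    finally show "op_poly V (pCons a p) (induced_op A T) (cl u)
        = seq_op (\<lambda>n. ev (of_real_poly (pCons a p))) (cl u)" .
  qed (unfold step op_add_def, rule restrict_extensional)
qed

lemma ev_diff_le:
  assumes "\<And>t. t \<in> {0..T_norm} \<Longrightarrow> \<bar>poly p t - poly q t\<bar> \<le> e"
  shows "nrm (ev (of_real_poly p) x - ev (of_real_poly q) x) \<le> e * nrm x"
  using poly_norm_le[of "p - q" e x] assms
  by (simp add: of_real_poly_diff ev_diff)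

text \<open>With \<open>q = p\<close> this is the Cauchy property; with two different sequences it
  shows that the limit does not depend on the approximating polynomials.\<close>

lemma uniform_limits_ev_diff_le:
  assumes p: "uniform_limit {0..T_norm} (\<lambda>n. poly (p n)) f sequentially"
    and q: "uniform_limit {0..T_norm} (\<lambda>n. poly (q n)) f sequentially"
    and e: "e > 0"
  shows "\<exists>N. \<forall>m\<ge>N. \<forall>n\<ge>N. \<forall>x.
    nrm (ev (of_real_poly (p m)) x - ev (of_real_poly (q n)) x) \<le> e * nrm x"
proof -
  have e2: "e / 2 > 0" using e by simp
  obtain N where N: "\<And>n t. n \<ge> N \<Longrightarrow> t \<in> {0..T_norm} \<Longrightarrow> dist (poly (p n) t) (f t) < e / 2"
    using p e2 unfolding uniform_limit_sequentially_iff by meson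
  obtain N' where N': "\<And>n t. n \<ge> N' \<Longrightarrow> t \<in> {0..T_norm} \<Longrightarrow> dist (poly (q n) t) (f t) < e / 2"
    using q e2 unfolding uniform_limit_sequentially_iff by meson
  have "\<bar>poly (p m) t - poly (q n) t\<bar> \<le> e"
    if "max N N' \<le> m" "max N N' \<le> n" "t \<in> {0..T_norm}" for m n t
    using N[of m t] N'[of n t] that unfolding dist_real_def by linarith
  hence "nrm (ev (of_real_poly (p m)) x - ev (of_real_poly (q n)) x) \<le> e * nrm x"
    if "max N N' \<le> m" "max N N' \<le> n" for m n x
    using that by (intro ev_diff_le)
  thus ?thesis by blast
qed

section \<open>Real powers as limits of polynomials\<close>

context
  fixes p :: "nat \<Rightarrow> real poly" and r :: real
  assumes lim: "uniform_limit {0..T_norm} (\<lambda>n. poly (p n)) (\<lambda>t. t powr r) sequentially"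
begin

lemma Cauchy_ops_limit: "Cauchy_ops (\<lambda>n. ev (of_real_poly (p n)))"
  unfolding Cauchy_ops_def
proof (intro conjI allI impI)
  obtain N where N: "\<And>m n x. N \<le> m \<Longrightarrow> N \<le> n \<Longrightarrow>
      nrm (ev (of_real_poly (p m)) x - ev (of_real_poly (p n)) x) \<le> 1 * nrm x"
    using uniform_limits_ev_diff_le[OF lim lim zero_less_one] by blast
  obtain K where K: "K \<ge> 0" "\<And>x. nrm (ev (of_real_poly (p N)) x) \<le> K * nrm x"
    using ev_bounded by blast
  have "nrm (ev (of_real_poly (p n)) x) \<le> (K + 1) * nrm x" if "N \<le> n" for n x
    using N[of n N x] K(2)[of x] that
      nrm_triangle[of "ev (of_real_poly (p n)) x - ev (of_real_poly (p N)) x" "ev (of_real_poly (p N)) x"]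
    by (simp add: distrib_right)
  thus "\<exists>K\<ge>0. \<forall>\<^sub>F n in sequentially. \<forall>x. nrm (ev (of_real_poly (p n)) x) \<le> K * nrm x"
    using K(1) by (intro exI[of _ "K + 1"]) (auto simp: eventually_sequentially)
  show "\<exists>N. \<forall>m\<ge>N. \<forall>n\<ge>N. \<forall>x.
      nrm (ev (of_real_poly (p m)) x - ev (of_real_poly (p n)) x) \<le> e * nrm x" if "e > 0" for e
    by (rule uniform_limits_ev_diff_le[OF lim lim that])
qed (simp_all add: ev_vec_add ev_vec_scale)

text \<open>The limit operator meets the defining condition for every approximating sequence. Any
  other candidate is the limit of the same \<open>p k\<close> of the induced operator, so its
  distance from this one is zero on each class.\<close>

lemma op_powr_eq: "op_powr V (induced_op A T) r = seq_op (\<lambda>n. ev (of_real_poly (p n)))"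
proof -
  let ?F = "induced_op A T" and ?Q = "seq_op (\<lambda>n. ev (of_real_poly (p n)))"
  let ?D = "\<lambda>q R. op_add V (op_poly V q ?F) (op_scale V (- 1) R)"
  note Qops = seq_op_in_ops[OF Cauchy_ops_limit]
  have DQ: "?D q ?Q = seq_op (\<lambda>n x. ev (of_real_poly q) x + (- 1) *\<^sub>C ev (of_real_poly (p n)) x)"
    and DQC: "Cauchy_ops (\<lambda>n x. ev (of_real_poly q) x + (- 1) *\<^sub>C ev (of_real_poly (p n)) x)" for q
    by (simp_all only: op_poly_eq op_uminus_seq_op[OF Cauchy_ops_limit]
        op_add_seq_op[OF Cauchy_ops_ev Cauchy_ops_uminus[OF Cauchy_ops_limit]]
        Cauchy_ops_add[OF Cauchy_ops_ev Cauchy_ops_uminus[OF Cauchy_ops_limit]])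
  have conv: "(\<lambda>n. op_norm V (?D (q n) ?Q)) \<longlonglongrightarrow> 0"
    if q: "uniform_limit {0..T_norm} (\<lambda>n. poly (q n)) (\<lambda>t. t powr r) sequentially" for q
  proof (rule LIMSEQ_I)
    fix e :: real assume e: "e > 0"
    hence "e / 2 > 0" by simp
    from uniform_limits_ev_diff_le[OF q lim this] obtain N where
      N: "\<And>m n x. N \<le> m \<Longrightarrow> N \<le> n \<Longrightarrow>
        nrm (ev (of_real_poly (q m)) x - ev (of_real_poly (p n)) x) \<le> e / 2 * nrm x" by blast
    have "norm (op_norm V (?D (q m) ?Q) - 0) < e" if m: "N \<le> m" for m
    proof -
      have "\<forall>\<^sub>F n in sequentially. \<forall>x.
          nrm (ev (of_real_poly (q m)) x + (- 1) *\<^sub>C ev (of_real_poly (p n)) x) \<le> e / 2 * nrm x"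
        using N m unfolding eventually_sequentially by (auto simp: scaleC_minus_one)
      hence "op_norm V (?D (q m) ?Q) \<le> e / 2"
        unfolding DQ using e by (intro op_norm_le vnorm_seq_op_le[OF DQC]) auto
      moreover have "0 \<le> op_norm V (?D (q m) ?Q)"
        unfolding DQ by (intro op_norm_ops_nonneg seq_op_in_ops DQC)
      ultimately show ?thesis using e by simp
    qed
    thus "\<exists>N. \<forall>m\<ge>N. norm (op_norm V (?D (q m) ?Q) - 0) < e" by blast
  qed
  have uniq: "R = ?Q" if R: "R \<in> ops V" and convR: "(\<lambda>n. op_norm V (?D (p n) R)) \<longlonglongrightarrow> 0" for R
  proof (rule seq_op_eqI)
    show "R \<in> extensional (vcarrier V)" using R by (auto simp: ops_def PiE_def)
    fix u assume u: "u \<in> A_Cauchy A"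
    note uV = cl_in_carrier[OF u]
    have "R (cl u) \<in> vcarrier V" using R uV by (auto simp: ops_def)
    then obtain w where w: "w \<in> A_Cauchy A" "R (cl u) = cl w" by (rule carrierE)
    \<comment> \<open>\<open>b\<close> runs along the diagonal and represents the value of
      \<open>?Q\<close>. In \<open>a k\<close> below the polynomial stays fixed, representing the
      value of \<open>p k\<close> of the induced operator.\<close>
    define b where "b = (\<lambda>n. ev (of_real_poly (p n)) (u n))"
    have b: "b \<in> A_Cauchy A" "?Q (cl u) = cl b"
      unfolding b_def using Cauchy_ops_apply[OF Cauchy_ops_limit u] seq_op_cl[OF Cauchy_ops_limit u]
      by simp_all
    define a where "a k = (\<lambda>n. ev (of_real_poly (p k)) (u n))" for k
    have a: "a k \<in> A_Cauchy A" for k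
      unfolding a_def by (rule Cauchy_ops_apply[OF Cauchy_ops_ev u])
    have Dcl: "?D (p k) R' (cl y) = cl (\<lambda>n. ev (of_real_poly (p k)) (y n) + (- 1) *\<^sub>C z n)"
      if "y \<in> A_Cauchy A" "z \<in> A_Cauchy A" "R' (cl y) = cl z" for k R' y z
      using that by (simp add: op_add_def op_scale_def op_poly_eq seq_op_cl[OF Cauchy_ops_ev]
          cl_in_carrier vscale_cl vadd_cl Cauchy_ops_apply[OF Cauchy_ops_ev] A_Cauchy_scale)
    have Dle: "vnorm V (?D (p k) R' (cl u)) \<le> op_norm V (?D (p k) R') * vnorm V (cl u)"
      if "R' \<in> ops V" for k R'
      unfolding op_poly_eq
      by (intro vnorm_le_op_norm_ops op_add_in_ops op_scale_in_ops seq_op_in_ops Cauchy_ops_ev uV that)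
    have wb: "(\<lambda>n. w n + (- 1) *\<^sub>C b n) \<in> A_Cauchy A"
      by (intro A_Cauchy_add A_Cauchy_scale w b)
    define l where "l = vnorm V (cl (\<lambda>n. w n + (- 1) *\<^sub>C b n))"
    have lim_l: "(\<lambda>n. nrm (w n - b n)) \<longlonglongrightarrow> l"
      using vnorm_cl[OF wb] by (simp add: l_def scaleC_minus_one)
    \<comment> \<open>The distance \<open>l\<close> between the two values is estimated through
      \<open>a k\<close> for fixed \<open>k\<close>; only afterwards does \<open>k\<close> tend to
      infinity.\<close>
    have "l \<le> (op_norm V (?D (p k) R) + op_norm V (?D (p k) ?Q)) * vnorm V (cl u)" for k
    proof -
      have lims: "(\<lambda>n. nrm (a k n - z n)) \<longlonglongrightarrow> vnorm V (?D (p k) R' (cl u))"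
        if "z \<in> A_Cauchy A" "R' (cl u) = cl z" for R' z
        unfolding Dcl[of u z R' k, OF u that]
        using vnorm_cl[OF A_Cauchy_add[OF a[of k] A_Cauchy_scale[OF that(1), of "- 1"]]]
        by (simp add: a_def scaleC_minus_one)
      have "l \<le> vnorm V (?D (p k) R (cl u)) + vnorm V (?D (p k) ?Q (cl u))"
      proof (rule tendsto_le[OF _ tendsto_add[OF lims[of w R, OF w] lims[of b ?Q, OF b]] lim_l])
        show "\<forall>\<^sub>F n in sequentially. nrm (w n - b n) \<le> nrm (a k n - w n) + nrm (a k n - b n)"
          unfolding nrm_minus_commute[of "a k _" "w _"]
          by (intro always_eventually allI nrm_triangle_diff)
      qed simp
      also have "\<dots> \<le> op_norm V (?D (p k) R) * vnorm V (cl u) + op_norm V (?D (p k) ?Q) * vnorm V (cl u)"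
        by (intro add_mono Dle R Qops)
      finally show ?thesis by (simp only: distrib_right)
    qed
    moreover have "(\<lambda>k. (op_norm V (?D (p k) R) + op_norm V (?D (p k) ?Q)) * vnorm V (cl u)) \<longlonglongrightarrow> 0"
      by (intro tendsto_mult_left_zero tendsto_add_zero convR conv lim)
    ultimately have "l \<le> 0" by (intro LIMSEQ_le_const) auto
    moreover have "0 \<le> l" unfolding l_def by (intro vnorm_nonneg cl_in_carrier wb)
    ultimately have "(\<lambda>n. nrm (w n - b n)) \<longlonglongrightarrow> 0" using lim_l by simp
    thus "R (cl u) = ?Q (cl u)" using w b by (simp add: cl_eq_iff)
  qed
  show ?thesis
    unfolding op_powr_def using Qops conv uniq lim by (intro the_equality) blast+
qed

text \<open>
  For a unit vector \<open>x\<close> and \<open>s = \<langle>Tx, x\<rangle>\<close>, apply the tangent to the power function at \<open>s\<close>.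
\<close>

lemma McCarthy:
  assumes x: "nrm x = 1" and r: "r \<ge> 1" and e: "e > 0"
  shows "\<forall>\<^sub>F n in sequentially.
    Re (A_inner A (blinfun_apply T x) x) powr r - e \<le> Re (A_inner A (ev (of_real_poly (p n)) x) x)"
proof -
  define s where "s = Re (A_inner A (blinfun_apply T x) x)"
  define c1 where "c1 = r * s powr (r - 1)"
  \<comment> \<open>\<open>c0 + c1 t\<close> is the tangent lowered by \<open>e\<close>. It stays
    below \<open>p n\<close> once \<open>p n\<close> is within \<open>e\<close> of the power
    function, and its value at \<open>s\<close> is \<open>s powr r - e\<close>.\<close>
  define c0 where "c0 = s powr r - c1 * s - e"
  have s: "0 \<le> s" unfolding s_def by (rule T_pos)
  from lim e have "\<forall>\<^sub>F n in sequentially. \<forall>t\<in>{0..T_norm}. dist (poly (p n) t) (t powr r) < e"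
    by (rule uniform_limitD)
  thus ?thesis
  proof eventually_elim
    case (elim n)
    have "0 \<le> Re (A_inner A (ev (of_real_poly (p n - [:c0, c1:])) x) x)"
    proof (rule poly_positive)
      fix t assume t: "t \<in> {0..T_norm}"
      have "s powr r + c1 * (t - s) \<le> t powr r"
        unfolding c1_def using t s r by (intro powr_tangent_le) auto
      moreover have "t powr r - e < poly (p n) t"
        using bspec[OF elim t] unfolding dist_real_def by linarith
      ultimately show "0 \<le> poly (p n - [:c0, c1:]) t"
        by (simp add: c0_def algebra_simps)
    qed
    also have "A_inner A (ev (of_real_poly (p n - [:c0, c1:])) x) x
        = A_inner A (ev (of_real_poly (p n)) x) x - (complex_of_real c0 * A_inner A x x
            + complex_of_real c1 * A_inner A (blinfun_apply T x) x)"
      by (simp add: of_real_poly_diff map_poly_pCons ev_diff diff_left add_left scale_left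
          S_scale)
    finally have "c0 + c1 * s \<le> Re (A_inner A (ev (of_real_poly (p n)) x) x)"
      using x by (simp add: self_eq s_def)
    thus ?case by (simp add: c0_def s_def)
  qed
qed

end

end

context positive_operator
begin

text \<open>The sum of powers is \<open>seq_op\<close> of a sum of polynomials. McCarthy's
  inequality for both summands bounds its form at \<open>x\<close> from below, Cauchy-Schwarz passes
  to the seminorm, and the limit reaches the operator norm.\<close>

lemma A_norm_sum_powr_bounds:
  assumes S: "A_positive_operator A S" and R: "A_positive_operator A R" and r: "r \<ge> 1"
  shows A_norm_sum_powr_nonneg: "0 \<le> A_norm_sum_powr A S R r"
    and A_norm_sum_powr_ge: "nrm x = 1 \<Longrightarrow> Re (A_inner A (blinfun_apply S x) x) powr r
      + Re (A_inner A (blinfun_apply R x) x) powr r \<le> A_norm_sum_powr A S R r"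
proof -
  interpret S: A_positive_operator A S by fact
  interpret R: A_positive_operator A R by fact
  have r0: "r > 0" using r by simp
  obtain p where p: "uniform_limit {0..S.T_norm} (\<lambda>n. poly (p n)) (\<lambda>t. t powr r) sequentially"
    using powr_poly_approximation[OF r0] .
  obtain q where q: "uniform_limit {0..R.T_norm} (\<lambda>n. poly (q n)) (\<lambda>t. t powr r) sequentially"
    using powr_poly_approximation[OF r0] .
  let ?g = "\<lambda>n x. S.ev (of_real_poly (p n)) x + R.ev (of_real_poly (q n)) x"
  have g: "Cauchy_ops ?g"
    by (rule Cauchy_ops_add[OF S.Cauchy_ops_limit[OF p] R.Cauchy_ops_limit[OF q]])
  have eq: "A_norm_sum_powr A S R r = op_norm V (seq_op ?g)"
    unfolding A_norm_sum_powr_def S.op_powr_eq[OF p] R.op_powr_eq[OF q]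
      op_add_seq_op[OF S.Cauchy_ops_limit[OF p] R.Cauchy_ops_limit[OF q]] ..
  show "0 \<le> A_norm_sum_powr A S R r"
    unfolding eq by (intro op_norm_ops_nonneg seq_op_in_ops g)
  assume x: "nrm x = 1"
  let ?s = "Re (A_inner A (blinfun_apply S x) x) powr r + Re (A_inner A (blinfun_apply R x) x) powr r"
  have "vnorm V (seq_op ?g (cl (\<lambda>n. x))) \<le> op_norm V (seq_op ?g) * vnorm V (cl (\<lambda>n. x))"
    by (intro vnorm_le_op_norm_ops seq_op_in_ops g cl_in_carrier A_Cauchy_const)
  hence le: "vnorm V (cl (\<lambda>n. ?g n x)) \<le> A_norm_sum_powr A S R r"
    by (simp only: seq_op_cl[OF g A_Cauchy_const] vnorm_cl_const x eq mult_1_right)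
  have lim: "(\<lambda>n. nrm (?g n x)) \<longlonglongrightarrow> vnorm V (cl (\<lambda>n. ?g n x))"
    by (rule vnorm_cl[OF Cauchy_ops_apply[OF g A_Cauchy_const]])
  have "?s \<le> A_norm_sum_powr A S R r + e" if e: "e > 0" for e
  proof -
    have "e / 2 > 0" using e by simp
    from S.McCarthy[OF p x r this] R.McCarthy[OF q x r this]
    have "\<forall>\<^sub>F n in sequentially. ?s - e \<le> nrm (?g n x)"
    proof eventually_elim
      case (elim n)
      have "Re (A_inner A (?g n x) x) \<le> nrm (?g n x)"
        using Cauchy_Schwarz[of "?g n x" x] complex_Re_le_cmod[of "A_inner A (?g n x) x"] x by simp
      thus ?case using elim by (simp add: add_left)
    qed
    hence "?s - e \<le> vnorm V (cl (\<lambda>n. ?g n x))"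
      by (rule tendsto_lowerbound[OF lim]) simp
    thus ?thesis using le by linarith
  qed
  thus "?s \<le> A_norm_sum_powr A S R r" by (rule field_le_epsilon)
qed

end

section \<open>The numerical radius inequality\<close>

context positive_operator
begin

lemma A_inner_adjoint':
  assumes "T \<in> A_adjointable A"
  shows "A_inner A (blinfun_apply (A_adjoint A T) x) y = A_inner A x (blinfun_apply T y)"
  by (metis A_inner_adjoint[OF assms] conj_sym)

lemma A_positive_adjoint_comp:
  assumes T: "T \<in> A_adjointable A"
  shows "A_positive_operator A (A_adjoint A T o\<^sub>L T)"
    and "A_positive_operator A (T o\<^sub>L A_adjoint A T)"
proof -
  have "T \<in> bounded_ops" using T by (simp add: A_adjointable_def)
  hence ops: "A_adjoint A T o\<^sub>L T \<in> bounded_ops" "T o\<^sub>L A_adjoint A T \<in> bounded_ops"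
    using A_adjoint_properties(1)[OF T] by (simp_all add: bounded_ops_compose)
  show "A_positive_operator A (A_adjoint A T o\<^sub>L T)"
    by unfold_locales
      (simp_all add: ops A_inner_adjoint[OF T] A_inner_adjoint'[OF T] nonneg
        flip: A_inner_adjoint[OF T])
  show "A_positive_operator A (T o\<^sub>L A_adjoint A T)"
    by unfold_locales
      (simp_all add: ops A_inner_adjoint[OF T] A_inner_adjoint'[OF T] nonneg
        flip: A_inner_adjoint'[OF T])
qed

text \<open>Homogeneity extends the bound from unit vectors. The constant \<open>K\<close> ensures
  that the supremum is taken over a bounded set.\<close>

lemma A_inner_le_numerical_radius:
  assumes T: "T \<in> bounded_ops" and K: "\<And>x. nrm (blinfun_apply T x) \<le> K * nrm x"
  shows "cmod (A_inner A (blinfun_apply T x) x) \<le> A_numerical_radius A T * (nrm x)\<^sup>2"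
proof (cases "nrm x = 0")
  case True
  thus ?thesis using Cauchy_Schwarz[of "blinfun_apply T x" x] by simp
next
  case False
  hence n: "nrm x > 0" by (simp add: less_le)
  define u where "u = complex_of_real (1 / nrm x) *\<^sub>C x"
  let ?W = "insert 0 {cmod (A_inner A (blinfun_apply T x) x) | x. A_norm A x = 1}"
  have u: "nrm u = 1" using n by (simp add: u_def nrm_scale norm_divide)
  have "bdd_above ?W"
  proof (rule bdd_aboveI[of _ "max 0 K"])
    fix w assume "w \<in> ?W"
    then consider "w = 0" | y where "w = cmod (A_inner A (blinfun_apply T y) y)" "nrm y = 1"
      unfolding A_norm_eq by blast
    thus "w \<le> max 0 K"
    proof cases
      case (2 y)
      thus ?thesis using Cauchy_Schwarz[of "blinfun_apply T y" y] K[of y] by simp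
    qed simp
  qed
  moreover have "cmod (A_inner A (blinfun_apply T u) u) \<in> ?W"
    using u unfolding A_norm_eq by blast
  ultimately have "cmod (A_inner A (blinfun_apply T u) u) \<le> A_numerical_radius A T"
    unfolding A_numerical_radius_def by (intro cSup_upper)
  moreover have "A_inner A (blinfun_apply T u) u
      = complex_of_real ((1 / nrm x)\<^sup>2) * A_inner A (blinfun_apply T x) x"
    by (simp add: u_def bounded_ops_scaleC[OF T] scale_left scale_right power2_eq_square)
  hence "cmod (A_inner A (blinfun_apply T u) u) = cmod (A_inner A (blinfun_apply T x) x) / (nrm x)\<^sup>2"
    using n by (simp add: norm_mult norm_divide norm_power power_divide)
  ultimately show ?thesis using n by (simp add: pos_divide_le_eq)
qed

text \<open>Midpoint convexity for the normalized vector, followed by an \<open>r\<close>-th root.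
  The factor \<open>(nrm x)\<^sup>2\<close> serves the components of a unit vector of the direct
  sum, and the free bound \<open>L\<close> lets one constant cover both norms.\<close>

lemma half_sum_le_A_norm_sum_powr:
  assumes S: "A_positive_operator A S" and R: "A_positive_operator A R" and r: "r \<ge> 1"
    and L: "A_norm_sum_powr A S R r \<le> L"
  shows "(Re (A_inner A (blinfun_apply S x) x) + Re (A_inner A (blinfun_apply R x) x)) / 2
      \<le> (L / 2) powr (1 / r) * (nrm x)\<^sup>2"
proof -
  interpret S: A_positive_operator A S by fact
  interpret R: A_positive_operator A R by fact
  show ?thesis
  proof (cases "nrm x = 0")
    case True
    thus ?thesis using S.S_le[of x] R.S_le[of x] by simp
  next
    case False
    hence n: "nrm x > 0" by (simp add: less_le)
    define u where "u = complex_of_real (1 / nrm x) *\<^sub>C x"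
    have u: "nrm u = 1" using n by (simp add: u_def nrm_scale norm_divide)
    have x: "x = complex_of_real (nrm x) *\<^sub>C u" using n by (simp add: u_def scaleC_scaleC)
    have quad: "Re (A_inner A (blinfun_apply T x) x) = (nrm x)\<^sup>2 * Re (A_inner A (blinfun_apply T u) u)"
      if "T \<in> bounded_ops" for T
      by (subst (1 2) x)
        (simp add: bounded_ops_scaleC[OF that] scale_left scale_right power2_eq_square)
    let ?s = "Re (A_inner A (blinfun_apply S u) u)" and ?t = "Re (A_inner A (blinfun_apply R u) u)"
    have "((?s + ?t) / 2) powr r \<le> (?s powr r + ?t powr r) / 2"
      by (rule powr_midpoint_le[OF S.T_pos R.T_pos r])
    also have "\<dots> \<le> L / 2"
      using A_norm_sum_powr_ge[OF S R r u] L by simp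
    finally have "(((?s + ?t) / 2) powr r) powr (1 / r) \<le> (L / 2) powr (1 / r)"
      using r by (intro powr_mono2) auto
    hence "(?s + ?t) / 2 \<le> (L / 2) powr (1 / r)"
      using r S.T_pos[of u] R.T_pos[of u] by (simp add: powr_powr)
    hence "(nrm x)\<^sup>2 * ((?s + ?t) / 2) \<le> (nrm x)\<^sup>2 * (L / 2) powr (1 / r)"
      by (rule mult_left_mono) simp
    thus ?thesis
      unfolding quad[OF S.T_ops] quad[OF R.T_ops] by (simp add: distrib_left mult.commute)
  qed
qed

end

text \<open>
  With \<open>t = 1/(\<beta>+1)\<close>, four times the slack at \<open>L = 2a\<close>, \<open>w = b\<close> is
  \<open>(1 - t)a\<^sup>2 + tab - b\<^sup>2\<close>, which is nonnegative because \<open>b \<le> a\<close>.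
\<close>

lemma half_sum_sq_le:
  fixes a b L w \<beta> :: real
  assumes b: "0 \<le> b" and ba: "b \<le> a" and aL: "a \<le> L / 2" and bw: "b \<le> w" and \<beta>: "0 \<le> \<beta>"
  shows "((a + b) / 2)\<^sup>2 \<le> (2 * \<beta> + 1) / (16 * (\<beta> + 1)) * L\<^sup>2 + (2 * \<beta> + 3) / (8 * (\<beta> + 1)) * L * w"
proof -
  have a: "0 \<le> a" using b ba by simp
  have "(\<beta> + 1) * (a + b)\<^sup>2 \<le> (2 * \<beta> + 1) * a\<^sup>2 + (2 * \<beta> + 3) * (a * b)"
  proof -
    \<comment> \<open>The right side minus the left side is
      \<open>\<beta> (a\<^sup>2 - b\<^sup>2) + (a b - b\<^sup>2)\<close>.\<close>
    have "b * b \<le> a * b" "b * b \<le> a * a" using a b ba by (auto intro: mult_mono)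
    moreover from this have "\<beta> * (b * b) \<le> \<beta> * (a * a)" using \<beta> by (intro mult_left_mono)
    ultimately show ?thesis by (simp add: power2_eq_square algebra_simps)
  qed
  also have "\<dots> \<le> (2 * \<beta> + 1) * (L / 2)\<^sup>2 + (2 * \<beta> + 3) * (L / 2 * w)"
    using a b aL bw \<beta> by (intro add_mono mult_left_mono power_mono mult_mono) auto
  finally have "(\<beta> + 1) * (a + b)\<^sup>2 / (4 * (\<beta> + 1))
      \<le> ((2 * \<beta> + 1) * (L / 2)\<^sup>2 + (2 * \<beta> + 3) * (L / 2 * w)) / (4 * (\<beta> + 1))"
    using \<beta> by (intro divide_right_mono) auto
  also have "(\<beta> + 1) * (a + b)\<^sup>2 / (4 * (\<beta> + 1)) = ((a + b) / 2)\<^sup>2"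
  proof -
    have "k * s / (4 * k) = s / 4" if "k > 0" for k s :: real using that by simp
    from this[of "\<beta> + 1" "(a + b)\<^sup>2"] show ?thesis using \<beta> by (simp only: power_divide) simp
  qed
  also have "((2 * \<beta> + 1) * (L / 2)\<^sup>2 + (2 * \<beta> + 3) * (L / 2 * w)) / (4 * (\<beta> + 1))
      = (2 * \<beta> + 1) / (16 * (\<beta> + 1)) * L\<^sup>2 + (2 * \<beta> + 3) / (8 * (\<beta> + 1)) * L * w"
    using \<beta> by (simp add: divide_simps power2_eq_square) (simp add: algebra_simps)
  finally show ?thesis .
qed

text \<open>The power is applied to the supremum, so the pointwise bounds are first turned into
  bounds on \<open>v\<close> by a \<open>c\<close>-th root; the root also shows that the set is
  bounded above.\<close>

lemma powr_Sup_insert_0_le: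
  fixes W :: "real set"
  assumes "\<And>v. v \<in> W \<Longrightarrow> 0 \<le> v" "\<And>v. v \<in> W \<Longrightarrow> v powr c \<le> d" "0 \<le> d" "0 < c"
  shows "Sup (insert 0 W) powr c \<le> d"
proof -
  have le: "v \<le> d powr (1 / c)" if "v \<in> insert 0 W" for v
  proof (cases "v \<in> W")
    case True
    have "(v powr c) powr (1 / c) \<le> d powr (1 / c)"
      using assms(2)[OF True] \<open>0 < c\<close> by (intro powr_mono2) auto
    thus ?thesis using assms(1)[OF True] \<open>0 < c\<close> by (simp add: powr_powr)
  qed (use that in simp)
  hence "Sup (insert 0 W) \<le> d powr (1 / c)" by (intro cSup_least) auto
  moreover have "0 \<le> Sup (insert 0 W)"
    using le by (intro cSup_upper bdd_aboveI[of _ "d powr (1 / c)"]) auto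
  ultimately have "Sup (insert 0 W) powr c \<le> (d powr (1 / c)) powr c"
    using \<open>0 < c\<close> by (intro powr_mono2) auto
  thus ?thesis using \<open>0 < c\<close> \<open>0 \<le> d\<close> by (simp add: powr_powr)
qed

section \<open>Block operators on the direct sum\<close>

lemma block_op_apply:
  "blinfun_apply (block_op T11 T12 T21 T22) z
     = (blinfun_apply T11 (fst z) + blinfun_apply T12 (snd z),
        blinfun_apply T21 (fst z) + blinfun_apply T22 (snd z))"
  by (simp add: block_op.rep_eq)

lemma A_inner_block_diag:
  "A_inner (block_op A 0 0 A) z w = A_inner A (fst z) (fst w) + A_inner A (snd z) (snd w)"
  by (simp add: A_inner_def block_op_apply cinner_prod_def)

lemma (in positive_operator) positive_block_diag: "positive_operator (block_op A 0 0 A)"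
proof
  have "cinner (blinfun_apply (block_op A 0 0 A) z) z \<in> \<real>\<^sub>\<ge>\<^sub>0" for z
    using A_diag_Re[of "fst z"] A_diag_Re[of "snd z"]
    by (simp add: block_op_apply cinner_prod_def complex_nonneg_Reals_iff A_diag_Im)
  moreover have "block_op A 0 0 A \<in> bounded_ops"
    by (simp add: bounded_ops_def block_op_apply scaleC_prod_def bounded_ops_scaleC[OF A_ops])
  ultimately show "positive_op (block_op A 0 0 A)" by (simp add: positive_op_def)
qed

theorem theorem2p22:
  fixes A X Y :: "'h::chilbert_space \<Rightarrow>\<^sub>L 'h" and \<beta> r :: real
  assumes "positive_op A"
    and "X \<in> A_adjointable A" and "Y \<in> A_adjointable A"
    and "\<beta> \<ge> 0" and "r \<ge> 1"
  shows
    "let lam = A_norm_sum_powr A (A_adjoint A Y o\<^sub>L Y) (X o\<^sub>L A_adjoint A X) r;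
         mu = A_norm_sum_powr A (Y o\<^sub>L A_adjoint A Y) (A_adjoint A X o\<^sub>L X) r
     in A_numerical_radius (block_op A 0 0 A) (block_op 0 X Y 0) powr (4 * r)
          \<le> (2 * \<beta> + 1) / (16 * (\<beta> + 1)) * max (lam\<^sup>2) (mu\<^sup>2)
            + (2 * \<beta> + 3) / (8 * (\<beta> + 1)) * max lam mu
              * max (A_numerical_radius A (X o\<^sub>L Y) powr r) (A_numerical_radius A (Y o\<^sub>L X) powr r)"
proof -
  interpret positive_operator A by unfold_locales fact
  interpret AA: positive_operator "block_op A 0 0 A" by (rule positive_block_diag)
  note X = assms(2) and Y = assms(3) and \<beta> = assms(4) and r = assms(5)
  define lam where "lam = A_norm_sum_powr A (A_adjoint A Y o\<^sub>L Y) (X o\<^sub>L A_adjoint A X) r"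
  define mu where "mu = A_norm_sum_powr A (Y o\<^sub>L A_adjoint A Y) (A_adjoint A X o\<^sub>L X) r"
  define w1 where "w1 = A_numerical_radius A (X o\<^sub>L Y)"
  define w2 where "w2 = A_numerical_radius A (Y o\<^sub>L X)"
  define L where "L = max lam mu"
  define w where "w = max (w1 powr r) (w2 powr r)"
  have lam0: "0 \<le> lam" and mu0: "0 \<le> mu"
    unfolding lam_def mu_def by (intro A_norm_sum_powr_nonneg A_positive_adjoint_comp X Y r)+
  have L2: "max (lam\<^sup>2) (mu\<^sup>2) = L\<^sup>2"
    unfolding L_def using lam0 mu0 by (auto simp: max_def power2_le_iff_abs_le abs_le_square_iff[symmetric])
  have Xops: "X \<in> bounded_ops" and Yops: "Y \<in> bounded_ops"
    using X Y by (simp_all add: A_adjointable_def)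
  obtain KX where KX: "0 \<le> KX" "\<And>x. nrm (blinfun_apply X x) \<le> KX * nrm x"
    using A_adjointable_bounded[OF X] by blast
  obtain KY where KY: "0 \<le> KY" "\<And>x. nrm (blinfun_apply Y x) \<le> KY * nrm x"
    using A_adjointable_bounded[OF Y] by blast
  have XY: "cmod (A_inner A (blinfun_apply X (blinfun_apply Y x)) x) \<le> w1 * (nrm x)\<^sup>2" for x
  proof -
    have "nrm (blinfun_apply (X o\<^sub>L Y) x) \<le> (KX * KY) * nrm x" for x
      using order_trans[OF KX(2) mult_left_mono[OF KY(2) KX(1)]] by (simp add: mult.assoc)
    from A_inner_le_numerical_radius[OF bounded_ops_compose[OF Xops Yops] this]
    show ?thesis by (simp add: w1_def)
  qed
  have YX: "cmod (A_inner A (blinfun_apply Y (blinfun_apply X x)) x) \<le> w2 * (nrm x)\<^sup>2" for x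
  proof -
    have "nrm (blinfun_apply (Y o\<^sub>L X) x) \<le> (KY * KX) * nrm x" for x
      using order_trans[OF KY(2) mult_left_mono[OF KX(2) KY(1)]] by (simp add: mult.assoc)
    from A_inner_le_numerical_radius[OF bounded_ops_compose[OF Yops Xops] this]
    show ?thesis by (simp add: w2_def)
  qed
  let ?T = "blinfun_apply (block_op 0 X Y 0)" and ?B = "A_inner (block_op A 0 0 A)"
  let ?Xs = "blinfun_apply (A_adjoint A X)" and ?Ys = "blinfun_apply (A_adjoint A Y)"
  let ?R = "(2 * \<beta> + 1) / (16 * (\<beta> + 1)) * L\<^sup>2 + (2 * \<beta> + 3) / (8 * (\<beta> + 1)) * L * w"
  have bound: "cmod (?B (?T z) z) powr (4 * r) \<le> ?R" if z: "AA.nrm z = 1" for z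
  proof -
    obtain x y where xy: "z = (x, y)" by (cases z)
    \<comment> \<open>The adjoint of the block operator applied to \<open>z\<close>, written down
      componentwise from the adjoints of \<open>X\<close> and \<open>Y\<close>.\<close>
    define c where "c = (?Ys y, ?Xs x)"
    have Tz: "?T z = (blinfun_apply X y, blinfun_apply Y x)"
      by (simp add: xy block_op_apply)
    have unit: "(nrm x)\<^sup>2 + (nrm y)\<^sup>2 = 1"
      using AA.nrm_sq[of z] z by (simp add: A_inner_block_diag xy nrm_sq)
    have zc: "?B z c = ?B (?T z) z"
      unfolding A_inner_block_diag Tz c_def
      by (simp add: xy A_inner_adjoint[OF X] A_inner_adjoint[OF Y])
    \<comment> \<open>This is the form of the squared block operator at \<open>z\<close>: the square
      is diagonal with entries \<open>X Y\<close> and \<open>Y X\<close>.\<close>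
    have Tc: "?B (?T z) c = A_inner A (blinfun_apply Y (blinfun_apply X y)) y
        + A_inner A (blinfun_apply X (blinfun_apply Y x)) x"
      unfolding A_inner_block_diag Tz c_def
      by (simp add: A_inner_adjoint[OF X] A_inner_adjoint[OF Y])
    define a0 where "a0 = AA.nrm (?T z) * AA.nrm c"
    define b0 where "b0 = cmod (?B (?T z) c)"
    have b0: "0 \<le> b0" "b0 \<le> a0"
      unfolding a0_def b0_def using AA.Cauchy_Schwarz by auto
    \<comment> \<open>In Buzano's inequality both factors equal the form at \<open>?T z, z\<close>,
      by \<open>zc\<close>, so their product is a square.\<close>
    have "2 * (cmod (?B (?T z) z))\<^sup>2 \<le> a0 + b0"
      using AA.Buzano[OF z, of "?T z" c]
      by (simp add: zc a0_def b0_def norm_mult power2_eq_square)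
    hence v: "(cmod (?B (?T z) z))\<^sup>2 \<le> (a0 + b0) / 2" by simp
    have "b0 \<le> w2 * (nrm y)\<^sup>2 + w1 * (nrm x)\<^sup>2"
      unfolding b0_def Tc by (rule norm_triangle_le[OF add_mono[OF YX XY]])
    also have "\<dots> \<le> max w1 w2 * (nrm y)\<^sup>2 + max w1 w2 * (nrm x)\<^sup>2"
      by (intro add_mono mult_right_mono) auto
    also have "\<dots> = max w1 w2" using unit by (simp add: add.commute flip: distrib_left)
    finally have b0w: "b0 \<le> max w1 w2" .
    have bw: "b0 powr r \<le> w"
    proof -
      have "b0 powr r \<le> max w1 w2 powr r" using b0 b0w r by (intro powr_mono2) auto
      also have "\<dots> \<le> w" unfolding w_def by (cases "w1 \<le> w2") (simp_all add: max_def)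
      finally show ?thesis .
    qed
    have "2 * a0 \<le> (AA.nrm (?T z))\<^sup>2 + (AA.nrm c)\<^sup>2"
      unfolding a0_def using sum_squares_bound[of "AA.nrm (?T z)" "AA.nrm c"] by (simp add: mult.assoc)
    \<comment> \<open>Regrouping the four squares by the components \<open>x\<close> and
      \<open>y\<close> pairs the operators exactly as in \<open>lam\<close> and
      \<open>mu\<close>.\<close>
    also have "\<dots> = (Re (A_inner A (blinfun_apply (A_adjoint A Y o\<^sub>L Y) x) x)
          + Re (A_inner A (blinfun_apply (X o\<^sub>L A_adjoint A X) x) x))
        + (Re (A_inner A (blinfun_apply (Y o\<^sub>L A_adjoint A Y) y) y)
          + Re (A_inner A (blinfun_apply (A_adjoint A X o\<^sub>L X) y) y))"
      unfolding AA.nrm_sq A_inner_block_diag Tz c_def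
      by (simp add: A_inner_adjoint[OF X] A_inner_adjoint[OF Y] A_inner_adjoint'[OF X] A_inner_adjoint'[OF Y])
    finally have "a0 \<le> (Re (A_inner A (blinfun_apply (A_adjoint A Y o\<^sub>L Y) x) x)
          + Re (A_inner A (blinfun_apply (X o\<^sub>L A_adjoint A X) x) x)) / 2
        + (Re (A_inner A (blinfun_apply (Y o\<^sub>L A_adjoint A Y) y) y)
          + Re (A_inner A (blinfun_apply (A_adjoint A X o\<^sub>L X) y) y)) / 2" by argo
    also have "\<dots> \<le> (L / 2) powr (1 / r) * (nrm x)\<^sup>2 + (L / 2) powr (1 / r) * (nrm y)\<^sup>2"
      by (intro add_mono half_sum_le_A_norm_sum_powr A_positive_adjoint_comp X Y r)
        (simp_all add: L_def lam_def mu_def)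
    also have "\<dots> = (L / 2) powr (1 / r)" using unit by (simp flip: distrib_left)
    finally have "a0 powr r \<le> ((L / 2) powr (1 / r)) powr r"
      using b0 r by (intro powr_mono2) auto
    also have "\<dots> = L / 2" using r lam0 by (simp add: powr_powr L_def)
    finally have aL: "a0 powr r \<le> L / 2" .
    \<comment> \<open>The exponent is split as \<open>2 * r * 2\<close>: the inner square is bounded
      by Buzano, the power \<open>r\<close> by convexity, and the outer square by
      \<open>half_sum_sq_le\<close>.\<close>
    have "cmod (?B (?T z) z) powr (4 * r) = (((cmod (?B (?T z) z))\<^sup>2) powr r)\<^sup>2"
      by (simp add: powr_powr flip: powr_numeral)
    also have "\<dots> \<le> ((a0 powr r + b0 powr r) / 2)\<^sup>2"
    proof (rule power_mono)
      have "((cmod (?B (?T z) z))\<^sup>2) powr r \<le> ((a0 + b0) / 2) powr r"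
        using v r by (intro powr_mono2) auto
      also have "\<dots> \<le> (a0 powr r + b0 powr r) / 2"
        using b0 r by (intro powr_midpoint_le) auto
      finally show "((cmod (?B (?T z) z))\<^sup>2) powr r \<le> (a0 powr r + b0 powr r) / 2" .
    qed simp
    also have "\<dots> \<le> ?R"
      using b0 r aL bw \<beta> by (intro half_sum_sq_le) (auto intro: powr_mono2)
    finally show ?thesis .
  qed
  have L0: "0 \<le> L" and w0: "0 \<le> w"
    using lam0 by (simp_all add: L_def w_def le_max_iff_disj)
  have "A_numerical_radius (block_op A 0 0 A) (block_op 0 X Y 0) powr (4 * r) \<le> ?R"
    unfolding A_numerical_radius_def
  proof (rule powr_Sup_insert_0_le)
    show "0 \<le> ?R" using L0 w0 \<beta> by (intro add_nonneg_nonneg mult_nonneg_nonneg) auto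
  qed (use r bound in \<open>auto simp: AA.A_norm_eq\<close>)
  thus ?thesis
    unfolding Let_def lam_def[symmetric] mu_def[symmetric] w1_def[symmetric] w2_def[symmetric]
      L2 L_def[symmetric] w_def[symmetric] .
qed

end
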